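(* The area of the Lawson surfaces $\xi_{1,g}$ of genus $g$ is strictly monotonically increasing in $g$ for all integers $g\ge0$, i.e. $\operatorname{Area}(\xi_{1,g})<\operatorname{Area}(\xi_{1,g+1})$ for all $g\ge0$.
   Context: Lawson surface $\xi_{1,g}$: view $\mathbb S^3\subset\mathbb C^2$ as the round unit sphere and let $P_1=(1,0)$, $P_2=(i,0)$, $Q_1=(0,1)$, $Q_2=(0,e^{i\pi/(g+1)})$. The closed geodesic 4-gon whose edges are the geodesic arcs of length $\pi/2$ joining $P_i$ to $Q_j$ ($i,j\in\{1,2\}$) bounds an area-minimizing disk (the solution of the Plateau problem). $\xi_{1,g}$ is the closed embedded minimal surface of genus $g$ obtained from this disk by iterated Schwarz reflection (rotation by $\pi$) across the boundary geodesics. $\xi_{1,0}$ is the totally geodesic 2-sphere and $\xi_{1,1}$ is the Clifford torus. *)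

theory Defs
  imports "HOL-Analysis.Analysis"
begin

text \<open>The round three-sphere is \<open>sphere 0 1\<close> in \<open>complex \<times> complex\<close>, whose inner product is the
  Euclidean one of \<open>\<real>\<close>-dimension four.\<close>

definition quarter_arc :: "complex \<times> complex \<Rightarrow> complex \<times> complex \<Rightarrow> (complex \<times> complex) set" where
  \<comment> \<open>for orthonormal \<open>p\<close>, \<open>q\<close> this is the minimizing geodesic from \<open>p\<close> to \<open>q\<close>, of length \<open>\<pi>/2\<close>\<close>
  "quarter_arc p q = (\<lambda>t. cos t *\<^sub>R p + sin t *\<^sub>R q) ` {0..pi/2}"

definition half_turn :: "complex \<times> complex \<Rightarrow> complex \<times> complex \<Rightarrow> complex \<times> complex \<Rightarrow> complex \<times> complex" where
  \<comment> \<open>for orthonormal \<open>p\<close>, \<open>q\<close>: identity on their span, \<open>-1\<close> on its orthogonal complement, i.e.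
    Schwarz reflection across the great circle through \<open>p\<close> and \<open>q\<close>\<close>
  "half_turn p q x = 2 *\<^sub>R ((x \<bullet> p) *\<^sub>R p + (x \<bullet> q) *\<^sub>R q) - x"

definition P_vertices :: "(complex \<times> complex) set" where
  "P_vertices = {(1, 0), (\<i>, 0)}"

definition Q_vertices :: "nat \<Rightarrow> (complex \<times> complex) set" where
  "Q_vertices g = {(0, 1), (0, cis (pi / (real g + 1)))}"

definition lawson_polygon :: "nat \<Rightarrow> (complex \<times> complex) set" where
  "lawson_polygon g = (\<Union>p\<in>P_vertices. \<Union>q\<in>Q_vertices g. quarter_arc p q)"

definition disk_area :: "(complex \<Rightarrow> complex \<times> complex) \<Rightarrow> real" where
  "disk_area f = (LINT u:ball 0 1|lebesgue.
     (let fx = frechet_derivative f (at u) 1; fy = frechet_derivative f (at u) \<i>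
      in sqrt ((fx \<bullet> fx) * (fy \<bullet> fy) - (fx \<bullet> fy)\<^sup>2)))"

text \<open>Surfaces of disk type in the three-sphere with boundary curve \<open>\<Gamma>\<close>. Differentiability almost
  everywhere is automatic for Lipschitz maps (Rademacher's theorem); it is listed since
  \<open>frechet_derivative\<close> is unspecified at points where the derivative does not exist.\<close>

definition spanning_disk :: "(complex \<times> complex) set \<Rightarrow> (complex \<Rightarrow> complex \<times> complex) \<Rightarrow> bool" where
  "spanning_disk \<Gamma> f \<longleftrightarrow>
     (\<exists>L. lipschitz_on L (cball 0 1) f) \<and>
     (AE u in lebesgue. u \<in> ball 0 1 \<longrightarrow> f differentiable (at u)) \<and>
     f ` cball 0 1 \<subseteq> sphere 0 1 \<and>
     bij_betw f (sphere 0 1) \<Gamma>"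

text \<open>The solution is an embedded disk, while the competitors may be arbitrary Lipschitz disks.
  Embeddedness excludes degenerate parametrizations, for instance those that collapse part of the
  parameter disk to a curve sticking out of the surface, which does not change the area.\<close>

definition plateau_disk :: "(complex \<times> complex) set \<Rightarrow> (complex \<Rightarrow> complex \<times> complex) \<Rightarrow> bool" where
  "plateau_disk \<Gamma> f \<longleftrightarrow>
     spanning_disk \<Gamma> f \<and> inj_on f (cball 0 1) \<and>
     (\<forall>h. spanning_disk \<Gamma> h \<longrightarrow> disk_area f \<le> disk_area h)"

text \<open>The closed surface is represented by the set of its parametrized pieces, all those obtained
  from the disk \<open>f\<close> by iterated Schwarz reflection. Reflecting a piece \<open>\<gamma> \<circ> f\<close> across one of its own
  edges, the image under \<open>\<gamma>\<close> of an edge with half-turn \<open>\<sigma>\<close>, gives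
  \<open>(\<gamma> \<circ> \<sigma> \<circ> \<gamma>\<^sup>-\<^sup>1) \<circ> (\<gamma> \<circ> f) = \<gamma> \<circ> \<sigma> \<circ> f\<close>, which is again in this set. The group
  generated by the four half-turns has order \<open>4 (g + 1)\<close>, and distinct elements give distinct
  pieces.\<close>

inductive_set lawson_pieces :: "nat \<Rightarrow> (complex \<Rightarrow> complex \<times> complex) \<Rightarrow> (complex \<Rightarrow> complex \<times> complex) set"
  for g :: nat and f :: "complex \<Rightarrow> complex \<times> complex" where
  disk: "f \<in> lawson_pieces g f"
| reflect: "h \<in> lawson_pieces g f \<Longrightarrow> p \<in> P_vertices \<Longrightarrow> q \<in> Q_vertices g
    \<Longrightarrow> half_turn p q \<circ> h \<in> lawson_pieces g f"

definition lawson_surface :: "nat \<Rightarrow> (complex \<Rightarrow> complex \<times> complex) set \<Rightarrow> bool" where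
  "lawson_surface g S \<longleftrightarrow> (\<exists>f. plateau_disk (lawson_polygon g) f \<and> S = lawson_pieces g f)"

text \<open>The induced area of a compact surface that is cut into finitely many disks along
  curves: the integral of the area element over the glued surface. The seams have area zero.\<close>

definition surface_area :: "(complex \<Rightarrow> complex \<times> complex) set \<Rightarrow> real" where
  "surface_area S = (\<Sum>h\<in>S. disk_area h)"

end

theory Submission
  imports Defs
begin

text \<open>Write \<open>A\<^sub>g\<close> for the area of the Plateau disk, so that the surface has area \<open>4 (g + 1) A\<^sub>g\<close>
  and the claim is \<open>A\<^sub>g < c A\<close> for \<open>c = (g + 2) / (g + 1)\<close>, \<open>A = A\<^sub>g\<^sub>+\<^sub>1\<close>. Folding across hyperplanes,
  which preserves area, moves a minimizer \<open>f\<close> for \<open>g + 1\<close> into the region where \<open>z\<close> is in the closed first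
  quadrant and \<open>0 \<le> arg w \<le> \<pi> / (g + 2)\<close>. There the map \<open>(z, r e\<^sup>i\<^sup>\<theta>) \<mapsto> (z, r e\<^sup>i\<^sup>c\<^sup>\<theta>)\<close> carries one
  polygon to the other and increases area by at most the factor \<open>c\<close>, with equality only if almost every
  tangent plane contains the rotation direction \<open>\<partial>/\<partial>\<theta>\<close>. Such a disk is not stationary: pushing it
  into the direction \<open>1 + \<i>\<close> of the \<open>z\<close>-plane, with a factor depending on \<open>w\<close> that vanishes on the polygon,
  decreases its area to first order unless its area element vanishes almost everywhere. The latter is impossible:
  a linear projection to the plane maps the polygon bijectively onto the unit circle, hence the disk onto
  a set containing the unit disk (no retraction theorem), whereas the image would be a null set by Sard's theorem.\<close>

section \<open>The area element\<close>

text \<open>The constant \<open>c\<close> is both the ratio of the two polygon angles and the ratio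
  of the two numbers of pieces. So the crude bound by the factor \<open>c\<close> already gives the
  weak inequality, and the whole difficulty is strictness. A minimizer is only known to be Lipschitz
  and differentiable almost everywhere, and folding may destroy smoothness and embeddedness. So no
  minimal surface equation or unique continuation is available: equality is analysed at almost every
  point, and the folded disk is tested against one explicit family of competitors for its own
  polygon. What replaces smoothness is that at almost every point mapped into a hyperplane the
  differential is tangent to it. This makes folding preserve area, handles the stretch at w = 0,
  where it is not differentiable, and covers the points where the variation field vanishes. The
  variation works because moving towards 1 + \<i> in the z-plane shrinks w, hence the rotation
  circles, at a rate proportional to (1 + \<i>) \<bullet> z. This is nonnegative on the first
  quadrant and vanishes there only at z = 0.\<close>

definition gram :: "'a::real_inner \<Rightarrow> 'a \<Rightarrow> real" where
  "gram x y = (x \<bullet> x) * (y \<bullet> y) - (x \<bullet> y)\<^sup>2"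

definition jac :: "(complex \<Rightarrow> 'a::real_inner) \<Rightarrow> complex \<Rightarrow> real" where
  "jac f u = sqrt (gram (frechet_derivative f (at u) 1) (frechet_derivative f (at u) \<i>))"

definition lipschitz_disk :: "(complex \<Rightarrow> 'a::euclidean_space) \<Rightarrow> bool" where
  "lipschitz_disk f \<longleftrightarrow> (\<exists>L. L-lipschitz_on (cball 0 1) f) \<and>
     (AE u in lebesgue. u \<in> ball 0 1 \<longrightarrow> f differentiable (at u))"

lemma disk_area_jac: "disk_area f = (LINT u:ball 0 1|lebesgue. jac f u)"
  by (simp add: disk_area_def jac_def gram_def Let_def)

lemma spanning_disk_iff:
  "spanning_disk \<Gamma> f \<longleftrightarrow> lipschitz_disk f \<and> f ` cball 0 1 \<subseteq> sphere 0 1 \<and> bij_betw f (sphere 0 1) \<Gamma>"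
  by (auto simp: spanning_disk_def lipschitz_disk_def)

lemma gram_nonneg: "0 \<le> gram x y"
  using Cauchy_Schwarz_ineq[of x y] by (simp add: gram_def)

lemma gram_le: "gram x y \<le> (norm x)\<^sup>2 * (norm y)\<^sup>2"
  by (simp add: gram_def power2_norm_eq_inner)

lemma gram_linear_combination:
  "gram (a *\<^sub>R x + b *\<^sub>R y) (c *\<^sub>R x + d *\<^sub>R y) = (a * d - b * c)\<^sup>2 * gram x y"
  by (simp add: gram_def inner_add_left inner_add_right inner_commute[of y x] power2_eq_square
        algebra_simps)

lemma gram_scaleR_add: "gram x (y + c *\<^sub>R x) = gram x y"
  using gram_linear_combination[of 1 x 0 y c 1] by (simp add: add.commute)

text \<open>Adding a multiple of x to y changes neither side, so y may be taken orthogonal to x. The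
  right side is then the product of the squared norms, which always bounds
  \<open>gram\<close>.\<close>

lemma gram_contraction_le:
  assumes A: "linear A" "\<And>x. norm (A x) \<le> norm x"
  shows "gram (A x) (A y) \<le> gram x y"
proof (cases "x = 0")
  case True
  then show ?thesis by (simp add: gram_def linear_0[OF A(1)])
next
  case False
  define c where "c = - (x \<bullet> y) / (x \<bullet> x)"
  have o: "x \<bullet> (y + c *\<^sub>R x) = 0"
    using False by (simp add: c_def inner_add_right inner_diff_right)
  have "gram (A x) (A y) = gram (A x) (A (y + c *\<^sub>R x))"
    by (simp add: linear_add[OF A(1)] linear_scale[OF A(1)] gram_scaleR_add)
  also have "\<dots> \<le> (norm (A x))\<^sup>2 * (norm (A (y + c *\<^sub>R x)))\<^sup>2"
    by (rule gram_le)
  also have "\<dots> \<le> (norm x)\<^sup>2 * (norm (y + c *\<^sub>R x))\<^sup>2"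
    by (intro mult_mono power_mono A) auto
  also have "\<dots> = gram x (y + c *\<^sub>R x)"
    using o by (simp add: gram_def power2_norm_eq_inner)
  finally show ?thesis by (simp add: gram_scaleR_add)
qed

lemma gram_isometry:
  assumes A: "linear A" "\<And>x. norm (A x) = norm x"
  shows "gram (A x) (A y) = gram x y"
proof -
  have "A x \<bullet> A y = x \<bullet> y" for x y
    using A(2)[of x] A(2)[of y] A(2)[of "x + y"] 
    by (simp add: linear_add[OF A(1)] norm_eq_sqrt_inner inner_add_left inner_add_right inner_commute)
  then show ?thesis by (simp add: gram_def)
qed

lemma gram_eq_0_imp_parallel:
  fixes x y :: "'a::real_inner"
  assumes "gram x y = 0" "x \<noteq> 0 \<or> y \<noteq> 0"
  obtains h a b where "norm h = 1" "x = a *\<^sub>R h" "y = b *\<^sub>R h"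
proof -
  have *: "\<exists>h a b. norm h = 1 \<and> x = a *\<^sub>R h \<and> y = b *\<^sub>R h"
    if g: "gram x y = 0" and x: "x \<noteq> 0" for x y :: 'a
  proof -
    define c where "c = (x \<bullet> y) / (x \<bullet> x)"
    have c: "c * (x \<bullet> x) = x \<bullet> y" using x by (simp add: c_def)
    then have "(x \<bullet> x) * (y \<bullet> y - c * (x \<bullet> y)) = 0"
      using g by (simp add: gram_def power2_eq_square algebra_simps)
    then have "y \<bullet> y = c * (x \<bullet> y)" using x by simp
    then have "(y - c *\<^sub>R x) \<bullet> (y - c *\<^sub>R x) = 0"
      using c by (simp add: inner_diff_left inner_diff_right inner_commute[of y x])
    then have "y = c *\<^sub>R x" by simp
    then show ?thesis using x
      by (intro exI[of _ "x /\<^sub>R norm x"] exI[of _ "norm x"] exI[of _ "c * norm x"]) simp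
  qed
  show ?thesis
  proof (cases "x = 0")
    case True
    have "gram y x = 0" using assms(1) by (simp add: gram_def inner_commute mult.commute)
    with True assms(2) *[of y x] that show ?thesis by blast
  next
    case False
    with * [of x y] assms(1) that show ?thesis by blast
  qed
qed

lemma gram_linear_eq_0:
  assumes A: "linear A" and g: "gram x y = 0"
  shows "gram (A x) (A y) = 0"
proof (cases "x = 0 \<and> y = 0")
  case True
  then show ?thesis by (simp add: gram_def linear_0[OF A])
next
  case False
  then obtain h a b where "x = a *\<^sub>R h" "y = b *\<^sub>R h"
    using gram_eq_0_imp_parallel[OF g] by metis
  then show ?thesis
    using linear_scale[OF A] by (simp add: gram_def power2_eq_square)
qed

lemma jac_nonneg: "0 \<le> jac f u"
  by (simp add: jac_def gram_nonneg)

lemma jac_has_derivative: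
  "(f has_derivative D) (at u) \<Longrightarrow> jac f u = sqrt (gram (D 1) (D \<i>))"
  using frechet_derivative_at[of f D u] by (simp add: jac_def)

section \<open>Measurability and integrability of the area element\<close>

lemma lipschitz_diskD:
  assumes "lipschitz_disk f"
  shows "continuous_on (cball 0 1) f"
    and "AE u in lebesgue. u \<in> ball 0 1 \<longrightarrow> (f has_derivative frechet_derivative f (at u)) (at u)"
  using assms lipschitz_on_continuous_on by (auto simp: lipschitz_disk_def frechet_derivative_works)

text \<open>\<open>frechet_derivative\<close> comes from a choice operator and is not visibly
  measurable; along the fixed steps 1/(n+1) it is a limit of measurable difference quotients. The
  extension \<open>F\<close> by 0 keeps the quotients measurable on the whole plane and does not
  affect the limit at interior points.\<close>

lemma directional_limit:
  fixes f :: "complex \<Rightarrow> 'a::euclidean_space"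
  assumes D: "(f has_derivative D) (at u)" and u: "u \<in> ball 0 1"
  defines "F \<equiv> \<lambda>u. if u \<in> cball 0 1 then f u else 0"
  shows "(\<lambda>n. real (Suc n) *\<^sub>R (F (u + v /\<^sub>R real (Suc n)) - F u)) \<longlonglongrightarrow> D v"
proof (cases "v = 0")
  case True
  then show ?thesis
    using has_derivative_linear[OF D] by (simp add: linear_0)
next
  case False
  have FD: "(F has_derivative D) (at u)"
    by (rule has_derivative_transform_within_open[OF D open_ball u]) (simp add: F_def)
  have lin: "linear D" using D has_derivative_linear by blast
  define h where "h n = v /\<^sub>R real (Suc n)" for n
  have h0: "h \<longlonglongrightarrow> 0"
    unfolding h_def using tendsto_scaleR[OF LIMSEQ_inverse_real_of_nat tendsto_const[of v]] by simp
  have "filterlim h (at 0) sequentially"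
    unfolding filterlim_at using h0 False by (auto simp: h_def)
  then have "(\<lambda>n. norm (F (u + h n) - F u - D (h n)) / norm (h n)) \<longlonglongrightarrow> 0"
    using FD unfolding has_derivative_at by (auto intro: filterlim_compose)
  then have "(\<lambda>n. norm v * (norm (F (u + h n) - F u - D (h n)) / norm (h n))) \<longlonglongrightarrow> norm v * 0"
    by (intro tendsto_intros)
  moreover have "norm v * (norm (F (u + h n) - F u - D (h n)) / norm (h n))
      = norm (real (Suc n) *\<^sub>R (F (u + h n) - F u) - D v)" for n
  proof -
    have "real (Suc n) *\<^sub>R (F (u + h n) - F u) - D v
        = real (Suc n) *\<^sub>R (F (u + h n) - F u - D (h n))"
      by (simp add: h_def linear_scale[OF lin] scaleR_diff_right)
    then have "norm (real (Suc n) *\<^sub>R (F (u + h n) - F u) - D v)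
        = real (Suc n) * norm (F (u + h n) - F u - D (h n))"
      by (simp only: norm_scaleR abs_of_nat)
    moreover have "norm (h n) = norm v / real (Suc n)"
      by (simp add: h_def divide_inverse mult.commute)
    ultimately show ?thesis using False by simp
  qed
  ultimately have "(\<lambda>n. norm (real (Suc n) *\<^sub>R (F (u + h n) - F u) - D v)) \<longlonglongrightarrow> 0" by simp
  then show ?thesis unfolding h_def
    using LIM_zero_iff tendsto_norm_zero_iff by blast
qed

lemma lipschitz_derivative_bound:
  fixes f :: "complex \<Rightarrow> 'a::euclidean_space"
  assumes D: "(f has_derivative D) (at u)" and u: "u \<in> ball 0 1"
    and L: "L-lipschitz_on (cball 0 1) f"
  shows "norm (D v) \<le> L * norm v"
proof -
  let ?F = "\<lambda>u. if u \<in> cball 0 1 then f u else 0"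
  let ?G = "\<lambda>n. real (Suc n) *\<^sub>R (?F (u + v /\<^sub>R real (Suc n)) - ?F u)"
  have "(\<lambda>n. u + inverse (real (Suc n)) *\<^sub>R v) \<longlonglongrightarrow> u + 0 *\<^sub>R v"
    by (intro tendsto_intros LIMSEQ_inverse_real_of_nat)
  then have "eventually (\<lambda>n. u + v /\<^sub>R real (Suc n) \<in> ball 0 1) sequentially"
    using u by (intro topological_tendstoD) auto
  then have "eventually (\<lambda>n. norm (?G n) \<le> L * norm v) sequentially"
  proof eventually_elim
    case (elim n)
    have "norm (f (u + v /\<^sub>R real (Suc n)) - f u) \<le> L * norm (v /\<^sub>R real (Suc n))"
      using lipschitz_on_normD[OF L, of "u + v /\<^sub>R real (Suc n)" u] elim u by simp
    then have "real (Suc n) * norm (f (u + v /\<^sub>R real (Suc n)) - f u)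
        \<le> real (Suc n) * (L * norm (v /\<^sub>R real (Suc n)))"
      by (intro mult_left_mono) auto
    also have "\<dots> = L * norm v" by (simp del: of_nat_Suc)
    finally have "norm (real (Suc n) *\<^sub>R (f (u + v /\<^sub>R real (Suc n)) - f u)) \<le> L * norm v"
      by (simp only: norm_scaleR abs_of_nat)
    then show ?case using elim u by simp
  qed
  then show ?thesis
    by (intro tendsto_upperbound[OF tendsto_norm[OF directional_limit[OF D u]]]) auto
qed

lemma directional_derivative_measurable:
  fixes f :: "complex \<Rightarrow> 'a::euclidean_space"
  assumes f: "lipschitz_disk f"
  shows "(\<lambda>u. if u \<in> ball 0 1 then frechet_derivative f (at u) v else 0) \<in> borel_measurable lebesgue"
proof -
  define F where "F u = (if u \<in> cball 0 1 then f u else 0)" for u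
  let ?G = "\<lambda>n u. if u \<in> ball 0 1 then real (Suc n) *\<^sub>R (F (u + v /\<^sub>R real (Suc n)) - F u) else 0"
  have "(\<lambda>u. indicator (cball 0 1) u *\<^sub>R f u) \<in> borel_measurable borel"
    by (intro borel_measurable_continuous_on_indicator lipschitz_diskD[OF f]) simp
  also have "(\<lambda>u. indicator (cball 0 1) u *\<^sub>R f u) = F"
    by (auto simp: indicator_def F_def)
  finally have [measurable]: "F \<in> borel_measurable borel" .
  have "?G n \<in> borel_measurable borel" for n
    by (measurable, simp)
  then have "?G n \<in> borel_measurable lborel" for n
    by simp
  then have "?G n \<in> borel_measurable lebesgue" for n
    using measurable_completion by blast
  then have "(\<lambda>u. lim (\<lambda>n. ?G n u)) \<in> borel_measurable lebesgue"
    by (intro borel_measurable_lim_metric)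
  \<comment> \<open>Agreement almost everywhere is enough because Lebesgue measure is
    complete.\<close>
  moreover have "AE u in lebesgue. lim (\<lambda>n. ?G n u)
      = (if u \<in> ball 0 1 then frechet_derivative f (at u) v else 0)"
    using lipschitz_diskD(2)[OF f]
  proof eventually_elim
    case (elim u)
    show ?case
    proof (cases "u \<in> ball 0 1")
      case True
      then have "(\<lambda>n. ?G n u) \<longlonglongrightarrow> frechet_derivative f (at u) v"
        using directional_limit[of f "frechet_derivative f (at u)" u v] elim
        unfolding F_def by simp
      then show ?thesis using True limI by auto
    qed auto
  qed
  ultimately show ?thesis by (rule borel_measurable_AE)
qed

text \<open>The area element is bounded by the square of a Lipschitz constant, on a set of finite
  measure.\<close>

lemma jac_integrable:
  fixes f :: "complex \<Rightarrow> 'a::euclidean_space"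
  assumes f: "lipschitz_disk f"
  shows "set_integrable lebesgue (ball 0 1) (jac f)"
proof -
  obtain L where L: "L-lipschitz_on (cball 0 1) f"
    using f by (auto simp: lipschitz_disk_def)
  let ?D = "\<lambda>v u. if u \<in> ball 0 1 then frechet_derivative f (at u) v else 0"
  have [measurable]: "?D 1 \<in> borel_measurable lebesgue" "?D \<i> \<in> borel_measurable lebesgue"
    using directional_derivative_measurable[OF f] by blast+
  have "(\<lambda>u. sqrt (gram (?D 1 u) (?D \<i> u))) \<in> borel_measurable lebesgue"
    unfolding gram_def by measurable
  also have "(\<lambda>u. sqrt (gram (?D 1 u) (?D \<i> u))) = (\<lambda>u. indicator (ball 0 1) u *\<^sub>R jac f u)"
    by (auto simp: jac_def gram_def)
  finally have m: "(\<lambda>u. indicator (ball 0 1) u *\<^sub>R jac f u) \<in> borel_measurable lebesgue" .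
  have b: "AE u in lebesgue. u \<in> ball 0 1 \<longrightarrow> norm (indicator (ball 0 1) u *\<^sub>R jac f u) \<le> L * L"
    using lipschitz_diskD(2)[OF f]
  proof eventually_elim
    case (elim u)
    show ?case
    proof
      assume u: "u \<in> ball 0 1"
      let ?d = "frechet_derivative f (at u)"
      have L0: "0 \<le> L" using L lipschitz_on_nonneg by blast
      have n: "norm (?d 1) \<le> L" "norm (?d \<i>) \<le> L"
        using lipschitz_derivative_bound[OF _ u L] elim u by (metis norm_one norm_ii mult.right_neutral)+
      have "jac f u \<le> sqrt ((norm (?d 1))\<^sup>2 * (norm (?d \<i>))\<^sup>2)"
        unfolding jac_def by (intro real_sqrt_le_mono gram_le)
      also have "\<dots> = norm (?d 1) * norm (?d \<i>)"
        by (simp add: real_sqrt_mult)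
      also have "\<dots> \<le> L * L" by (intro mult_mono n L0) auto
      finally show "norm (indicator (ball 0 1) u *\<^sub>R jac f u) \<le> L * L"
        using u by (simp add: jac_nonneg)
    qed
  qed
  show ?thesis unfolding set_integrable_def
    by (rule integrableI_bounded_set[of "ball 0 1" _ _ "L * L"]) (use m b emeasure_bounded_finite[of "ball (0::complex) 1"] in auto)
qed

section \<open>Comparison of areas through the area element\<close>

lemma disk_area_mono:
  assumes f: "lipschitz_disk f" and h: "lipschitz_disk h"
    and le: "AE u in lebesgue. u \<in> ball 0 1 \<longrightarrow> jac f u \<le> c * jac h u"
  shows "disk_area f \<le> c * disk_area h"
proof -
  have "disk_area f \<le> (LINT u:ball 0 1|lebesgue. c * jac h u)"
    unfolding disk_area_jac using le
    by (intro set_integral_mono_AE jac_integrable[OF f] set_integrable_mult_right jac_integrable[OF h]) auto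
  then show ?thesis by (simp add: disk_area_jac)
qed

lemma disk_area_cong:
  assumes f: "lipschitz_disk f" and h: "lipschitz_disk h"
    and eq: "AE u in lebesgue. u \<in> ball 0 1 \<longrightarrow> jac f u = jac h u"
  shows "disk_area f = disk_area h"
proof (rule antisym)
  have "AE u in lebesgue. u \<in> ball 0 1 \<longrightarrow> jac f u \<le> 1 * jac h u"
    using eq by eventually_elim auto
  then show "disk_area f \<le> disk_area h"
    using disk_area_mono[OF f h, of 1] by auto
  have "AE u in lebesgue. u \<in> ball 0 1 \<longrightarrow> jac h u \<le> 1 * jac f u"
    using eq by eventually_elim auto
  then show "disk_area h \<le> disk_area f"
    using disk_area_mono[OF h f, of 1] by auto
qed

text \<open>The defect \<open>?d\<close> is nonnegative almost everywhere and its integral is at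
  most 0. This turns equality of areas into a pointwise statement.\<close>

lemma disk_area_mono_eqD:
  assumes f: "lipschitz_disk f" and h: "lipschitz_disk h"
    and le: "AE u in lebesgue. u \<in> ball 0 1 \<longrightarrow> jac f u \<le> c * jac h u"
    and ge: "c * disk_area h \<le> disk_area f"
  shows "AE u in lebesgue. u \<in> ball 0 1 \<longrightarrow> jac f u = c * jac h u"
proof -
  let ?d = "\<lambda>u. c * jac h u - jac f u"
  have i: "set_integrable lebesgue (ball 0 1) ?d"
    by (intro set_integral_diff set_integrable_mult_right jac_integrable f h)
  have "(LINT u:ball 0 1|lebesgue. ?d u) = c * disk_area h - disk_area f"
    unfolding disk_area_jac
    by (subst set_integral_diff) (auto intro: jac_integrable f h)
  then have "(LINT u:ball 0 1|lebesgue. ?d u) \<le> 0"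
    using ge by simp
  moreover have nn: "AE u in lebesgue. 0 \<le> indicator (ball 0 1) u *\<^sub>R ?d u"
    using le by eventually_elim (auto simp: indicator_def)
  ultimately have "(LINT u:ball 0 1|lebesgue. ?d u) = 0"
    unfolding set_lebesgue_integral_def using integral_nonneg_AE[OF nn] by linarith
  then have "AE u in lebesgue. indicator (ball 0 1) u *\<^sub>R ?d u = 0"
    using integral_nonneg_eq_0_iff_AE[OF _ nn] i
    unfolding set_lebesgue_integral_def set_integrable_def by blast
  then show ?thesis by eventually_elim (auto simp: indicator_def)
qed

section \<open>Critical points and null sets\<close>

lemma negligible_if_AE_ball:
  fixes P :: "'a::euclidean_space \<Rightarrow> bool"
  assumes "AE u in lebesgue. u \<in> ball 0 1 \<longrightarrow> P u"
  shows "negligible {u \<in> ball 0 1. \<not> P u}"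
proof -
  obtain N where "N \<in> null_sets lebesgue" "{u. \<not> (u \<in> ball 0 1 \<longrightarrow> P u)} \<subseteq> N"
    using assms by (auto simp: eventually_ae_filter)
  then have "negligible N" "{u \<in> ball 0 1. \<not> P u} \<subseteq> N"
    using negligible_iff_null_sets by auto
  then show ?thesis by (rule negligible_subset)
qed

text \<open>Without a continuous derivative there is no implicit function theorem. Instead h is
  completed by a coordinate to a plane map: where the partial derivative in direction 1 is nonzero,
  u \<mapsto> (h u, Im u) has injective derivative, and preimages of null sets under such maps are
  null. Here the null set is a line. Direction \<i> is treated with Re u.\<close>

lemma negligible_transverse_zeros:
  fixes h :: "complex \<Rightarrow> real"
  assumes "\<And>u. u \<in> S \<Longrightarrow> (h has_derivative D u) (at u)" "\<And>u. u \<in> S \<Longrightarrow> D u \<noteq> (\<lambda>v. 0)"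
  shows "negligible {u \<in> S. h u = 0}"
proof -
  have lin: "linear (D u)" if "u \<in> S" for u
    using assms(1)[OF that] has_derivative_linear by blast
  have D: "D u v = Re v * D u 1 + Im v * D u \<i>" if "u \<in> S" for u v
  proof -
    have "v = Re v *\<^sub>R 1 + Im v *\<^sub>R \<i>" by (simp add: complex_eq_iff)
    then have "D u v = D u (Re v *\<^sub>R 1 + Im v *\<^sub>R \<i>)" by simp
    then show ?thesis by (simp only: linear_add[OF lin[OF that]] linear_scale[OF lin[OF that]]) simp
  qed
  have T: "negligible {z. Re z = 0}"
    using negligible_standard_hyperplane[of "1::complex" 0] by (simp add: inner_complex_def Basis_complex_def)
  let ?S = "\<lambda>b. {u \<in> S. D u b \<noteq> 0}"
  have "negligible {u \<in> ?S 1. Complex (h u) (Im u) \<in> {z. Re z = 0}}"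
  proof (rule negligible_differentiable_vimage[OF T])
    fix u assume u: "u \<in> ?S 1"
    show "((\<lambda>u. Complex (h u) (Im u)) has_derivative (\<lambda>v. Complex (D u v) (Im v))) (at u within ?S 1)"
    proof (rule has_derivative_at_withinI)
      have "(h has_derivative D u) (at u)" using u assms(1)[of u] by blast
      then show "((\<lambda>u. Complex (h u) (Im u)) has_derivative (\<lambda>v. Complex (D u v) (Im v))) (at u)"
        unfolding Complex_eq
        by (rule has_derivative_add[OF has_derivative_of_real
              has_derivative_mult_right[OF has_derivative_of_real[OF bounded_linear_imp_has_derivative[OF bounded_linear_Im]]]])
    qed
    show "inj (\<lambda>v. Complex (D u v) (Im v))"
    proof (rule injI)
      fix v w assume "Complex (D u v) (Im v) = Complex (D u w) (Im w)"
      then have "Im v = Im w" "D u v = D u w" by auto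
      then show "v = w" using u D[of u v] D[of u w] by (simp add: complex_eq_iff)
    qed
  qed
  moreover have "negligible {u \<in> ?S \<i>. Complex (h u) (Re u) \<in> {z. Re z = 0}}"
  proof (rule negligible_differentiable_vimage[OF T])
    fix u assume u: "u \<in> ?S \<i>"
    show "((\<lambda>u. Complex (h u) (Re u)) has_derivative (\<lambda>v. Complex (D u v) (Re v))) (at u within ?S \<i>)"
    proof (rule has_derivative_at_withinI)
      have "(h has_derivative D u) (at u)" using u assms(1)[of u] by blast
      then show "((\<lambda>u. Complex (h u) (Re u)) has_derivative (\<lambda>v. Complex (D u v) (Re v))) (at u)"
        unfolding Complex_eq
        by (rule has_derivative_add[OF has_derivative_of_real
              has_derivative_mult_right[OF has_derivative_of_real[OF bounded_linear_imp_has_derivative[OF bounded_linear_Re]]]])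
    qed
    show "inj (\<lambda>v. Complex (D u v) (Re v))"
    proof (rule injI)
      fix v w assume "Complex (D u v) (Re v) = Complex (D u w) (Re w)"
      then have "Re v = Re w" "D u v = D u w" by auto
      then show "v = w" using u D[of u v] D[of u w] by (simp add: complex_eq_iff)
    qed
  qed
  ultimately have "negligible ({u \<in> ?S 1. h u = 0} \<union> {u \<in> ?S \<i>. h u = 0})"
    by (intro negligible_Un) auto
  moreover have "{u \<in> S. h u = 0} \<subseteq> {u \<in> ?S 1. h u = 0} \<union> {u \<in> ?S \<i>. h u = 0}"
  proof
    fix u assume u: "u \<in> {u \<in> S. h u = 0}"
    then obtain v where "D u v \<noteq> 0" using assms(2) by blast
    then have "D u 1 \<noteq> 0 \<or> D u \<i> \<noteq> 0" using D[of u v] u by auto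
    then show "u \<in> {u \<in> ?S 1. h u = 0} \<union> {u \<in> ?S \<i>. h u = 0}" using u by blast
  qed
  ultimately show ?thesis by (rule negligible_subset)
qed

text \<open>The zeros of n \<bullet> f with nonzero differential form a null set by
  \<open>negligible_transverse_zeros\<close>, as do the points where f is not
  differentiable.\<close>

lemma AE_derivative_zero_on_hyperplane:
  fixes f :: "complex \<Rightarrow> 'a::euclidean_space"
  assumes f: "lipschitz_disk f"
  shows "AE u in lebesgue. u \<in> ball 0 1 \<longrightarrow> n \<bullet> f u = 0 \<longrightarrow>
    (\<forall>v. n \<bullet> frechet_derivative f (at u) v = 0)"
proof -
  let ?D = "\<lambda>u. frechet_derivative f (at u)"
  let ?S = "{u \<in> ball 0 1. (f has_derivative ?D u) (at u) \<and> (\<lambda>v. n \<bullet> ?D u v) \<noteq> (\<lambda>v. 0)}"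
  have "negligible {u \<in> ?S. n \<bullet> f u = 0}"
    by (rule negligible_transverse_zeros[where D = "\<lambda>u v. n \<bullet> ?D u v"])
       (auto intro: has_derivative_inner_right)
  then have "AE u in lebesgue. u \<notin> {u \<in> ?S. n \<bullet> f u = 0}"
    using negligible_iff_null_sets AE_not_in by blast
  with lipschitz_diskD(2)[OF f] show ?thesis
    by eventually_elim (auto simp: fun_eq_iff)
qed

lemma gram_eq_0_imp_dependent:
  fixes D :: "complex \<Rightarrow> 'a::real_inner"
  assumes D: "linear D" and g: "gram (D 1) (D \<i>) = 0"
  shows "\<not> inj D"
proof
  assume inj: "inj D"
  have "D 1 \<noteq> D 0" "D \<i> \<noteq> D 0" using inj by (auto dest: injD)
  then have ne: "D 1 \<noteq> 0" "D \<i> \<noteq> 0" by (simp_all add: linear_0[OF D])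
  then obtain h a b where h: "D 1 = a *\<^sub>R h" "D \<i> = b *\<^sub>R h"
    using gram_eq_0_imp_parallel[OF g] by metis
  have "D (b *\<^sub>R 1) = D (a *\<^sub>R \<i>)"
    by (simp only: linear_scale[OF D] h scaleR_scaleR mult.commute)
  then have "b *\<^sub>R 1 = a *\<^sub>R \<i>" using inj by (rule injD[rotated])
  then have "b = 0" by (simp add: complex_eq_iff)
  then show False using ne h by simp
qed

text \<open>Sard's theorem in equal dimensions, where differentiability at each point of the set
  suffices. \<open>baby_Sard\<close> speaks about \<open>real^2\<close>, hence the linear transport
  by \<open>p\<close> and \<open>q\<close>.\<close>

lemma negligible_singular_image:
  fixes G :: "complex \<Rightarrow> complex"
  assumes D: "\<And>u. u \<in> S \<Longrightarrow> (G has_derivative D u) (at u)" and ninj: "\<And>u. u \<in> S \<Longrightarrow> \<not> inj (D u)"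
  shows "negligible (G ` S)"
proof -
  define p :: "real^2 \<Rightarrow> complex" where "p v = Complex (v $ 1) (v $ 2)" for v
  define q :: "complex \<Rightarrow> real^2" where "q z = vector [Re z, Im z]" for z
  have pq: "p (q z) = z" for z by (simp add: p_def q_def)
  have qp: "q (p v) = v" for v by (simp add: p_def q_def vec_eq_iff forall_2)
  have lp: "linear p" by (auto simp: linear_iff p_def complex_eq_iff)
  have lq: "linear q" by (auto simp: linear_iff q_def vec_eq_iff forall_2)
  note dp = linear_imp_has_derivative[OF lp] and dq = linear_imp_has_derivative[OF lq]
  have "negligible ((\<lambda>v. q (G (p v))) ` (q ` S))"
  proof (rule baby_Sard[where f' = "\<lambda>v x. q (D (p v) (p x))"])
    fix v assume "v \<in> q ` S"
    then have v: "p v \<in> S" using pq by auto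
    show d: "((\<lambda>v. q (G (p v))) has_derivative (\<lambda>x. q (D (p v) (p x)))) (at v within q ` S)"
      by (rule has_derivative_compose[OF has_derivative_compose[OF dp D[OF v]] dq])
    obtain x y where "x \<noteq> y" "D (p v) x = D (p v) y"
      using ninj[OF v] by (auto simp: inj_def)
    then have "\<not> inj (\<lambda>x. q (D (p v) (p x)))"
      unfolding inj_def by (metis pq)
    then show "rank (matrix (\<lambda>x. q (D (p v) (p x)))) < CARD(2)"
      using less_rank_noninjective[of "matrix (\<lambda>x. q (D (p v) (p x)))"] has_derivative_linear[OF d]
      by (simp add: matrix_works linear_matrix_vector_mul_eq)
  qed simp
  then have "negligible (p ` (\<lambda>v. q (G (p v))) ` q ` S)"
    by (rule negligible_differentiable_image_negligible[rotated])
       (auto intro: linear_imp_differentiable_on[OF lp])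
  also have "p ` (\<lambda>v. q (G (p v))) ` q ` S = G ` S"
    by (auto simp: pq image_image)
  finally show ?thesis .
qed

text \<open>The circle and the null set of bad interior points have null image because the map is
  Lipschitz; the rest consists of critical points, whose image is null by Sard.\<close>

lemma negligible_lipschitz_disk_image:
  fixes G :: "complex \<Rightarrow> complex"
  assumes G: "lipschitz_disk G" and "AE u in lebesgue. u \<in> ball 0 1 \<longrightarrow> jac G u = 0"
  shows "negligible (G ` cball 0 1)"
proof -
  let ?D = "\<lambda>u. frechet_derivative G (at u)"
  let ?P = "\<lambda>u. (G has_derivative ?D u) (at u) \<and> jac G u = 0"
  obtain L where L: "L-lipschitz_on (cball 0 1) G"
    using G by (auto simp: lipschitz_disk_def)
  have "AE u in lebesgue. u \<in> ball 0 1 \<longrightarrow> ?P u"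
    using lipschitz_diskD(2)[OF G] assms(2) by eventually_elim auto
  then have N: "negligible (sphere 0 1 \<union> {u \<in> ball 0 1. \<not> ?P u})"
    by (intro negligible_Un negligible_sphere negligible_if_AE_ball)
  have "negligible (G ` (sphere 0 1 \<union> {u \<in> ball 0 1. \<not> ?P u}))"
  proof (rule negligible_locally_Lipschitz_image[OF order_refl N])
    fix x :: complex assume x: "x \<in> sphere 0 1 \<union> {u \<in> ball 0 1. \<not> ?P u}"
    show "\<exists>T B. open T \<and> x \<in> T \<and> (\<forall>y \<in> (sphere 0 1 \<union> {u \<in> ball 0 1. \<not> ?P u}) \<inter> T.
        norm (G y - G x) \<le> B * norm (y - x))"
      by (rule exI[of _ UNIV], rule exI[of _ L]) (use x in \<open>auto intro!: lipschitz_on_normD[OF L]\<close>)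
  qed
  moreover have "negligible (G ` {u \<in> ball 0 1. ?P u})"
    by (rule negligible_singular_image[where D = ?D])
       (auto simp: jac_def dest: gram_eq_0_imp_dependent[rotated] has_derivative_linear)
  ultimately have "negligible (G ` (sphere 0 1 \<union> {u \<in> ball 0 1. \<not> ?P u}) \<union> G ` {u \<in> ball 0 1. ?P u})"
    by (rule negligible_Un)
  then show ?thesis by (rule negligible_subset) force
qed

section \<open>Folding across hyperplanes\<close>

text \<open>For a unit normal n this replaces the coordinate n \<bullet> p by its absolute value:
  identity on one half-space, reflection on the other.\<close>

definition fold_across :: "'a::real_inner \<Rightarrow> 'a \<Rightarrow> 'a" where
  "fold_across n p = p + (\<bar>n \<bullet> p\<bar> - n \<bullet> p) *\<^sub>R n"

lemma fold_across_eq: "0 \<le> n \<bullet> p \<Longrightarrow> fold_across n p = p"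
  by (simp add: fold_across_def)

lemma fold_across_reflect: "n \<bullet> p \<le> 0 \<Longrightarrow> fold_across n p = p - (2 * (n \<bullet> p)) *\<^sub>R n"
  by (simp add: fold_across_def)

lemma norm_reflect:
  assumes "norm n = 1"
  shows "norm (p - (2 * (n \<bullet> p)) *\<^sub>R n) = norm p"
proof -
  have "n \<bullet> n = 1" using assms by (simp add: norm_eq_1)
  then show ?thesis
    by (simp add: norm_eq_sqrt_inner inner_diff_left inner_diff_right inner_commute[of p n])
qed

lemma norm_fold_across: "norm n = 1 \<Longrightarrow> norm (fold_across n p) = norm p"
  by (cases "0 \<le> n \<bullet> p") (auto simp: fold_across_eq fold_across_reflect norm_reflect)

text \<open>The optimal constant is 1; the triangle inequality gives 1 + 2, and any constant serves
  the purpose.\<close>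

lemma lipschitz_fold_across:
  assumes "norm n = 1"
  shows "3-lipschitz_on X (fold_across n)"
proof (rule lipschitz_onI)
  fix p q
  have "fold_across n p - fold_across n q
      = (p - q) + ((\<bar>n \<bullet> p\<bar> - \<bar>n \<bullet> q\<bar>) - n \<bullet> (p - q)) *\<^sub>R n"
    by (simp add: fold_across_def inner_diff_right algebra_simps)
  then have "norm (fold_across n p - fold_across n q) \<le> norm (p - q) + \<bar>(\<bar>n \<bullet> p\<bar> - \<bar>n \<bullet> q\<bar>) - n \<bullet> (p - q)\<bar>"
    using norm_triangle_ineq[of "p - q"] assms by (metis mult.right_neutral norm_scaleR real_norm_def)
  also have "\<dots> \<le> norm (p - q) + 2 * \<bar>n \<bullet> (p - q)\<bar>"
    using abs_triangle_ineq3[of "n \<bullet> p" "n \<bullet> q"]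
      abs_triangle_ineq4[of "\<bar>n \<bullet> p\<bar> - \<bar>n \<bullet> q\<bar>" "n \<bullet> p - n \<bullet> q"]
    by (simp add: inner_diff_right)
  also have "\<bar>n \<bullet> (p - q)\<bar> \<le> norm (p - q)"
    using Cauchy_Schwarz_ineq2[of n "p - q"] assms by simp
  finally show "dist (fold_across n p) (fold_across n q) \<le> 3 * dist p q"
    by (simp add: dist_norm)
qed simp

lemma has_derivative_abs_critical_zero:
  assumes "(g has_derivative (\<lambda>v. 0)) (at u)" "g u = 0"
  shows "((\<lambda>x. \<bar>g x :: real\<bar>) has_derivative (\<lambda>v. 0)) (at u)"
  using assms by (simp add: has_derivative_at)

lemma linear_reflect: "linear (\<lambda>p. p - (2 * (n \<bullet> p)) *\<^sub>R n)"
  by (auto simp: linear_iff inner_add_right algebra_simps)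

text \<open>Off the hyperplane the folded map is locally f or a reflected copy of f. On it, almost
  everywhere, n \<bullet> f is zero with zero differential, so its absolute value is differentiable
  there too and the derivative of f is unchanged.\<close>

lemma fold_across_jac:
  fixes f :: "complex \<Rightarrow> 'a::euclidean_space"
  assumes f: "lipschitz_disk f" and n: "norm n = 1"
  shows "AE u in lebesgue. u \<in> ball 0 1 \<longrightarrow>
    fold_across n \<circ> f differentiable (at u) \<and> jac (fold_across n \<circ> f) u = jac f u"
  using lipschitz_diskD(2)[OF f] AE_derivative_zero_on_hyperplane[OF f, of n]
proof eventually_elim
  case (elim u)
  let ?D = "frechet_derivative f (at u)"
  let ?h = "fold_across n \<circ> f"
  have cont: "continuous_on (ball 0 1) (\<lambda>u. n \<bullet> f u)"
    using lipschitz_diskD(1)[OF f] by (intro continuous_intros) (auto intro: continuous_on_subset)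
  show ?case
  proof
    assume u: "u \<in> ball 0 1"
    have D: "(f has_derivative ?D) (at u)" using elim u by blast
    have "\<exists>D'. (?h has_derivative D') (at u) \<and> gram (D' 1) (D' \<i>) = gram (?D 1) (?D \<i>)"
    proof (cases "n \<bullet> f u" "0::real" rule: linorder_cases)
      case equal
      then have Dn: "n \<bullet> ?D v = 0" for v using elim u by blast
      have g: "((\<lambda>u. n \<bullet> f u) has_derivative (\<lambda>v. 0)) (at u)"
        using has_derivative_inner_right[OF D, of n] Dn by simp
      have "((\<lambda>u. f u + (\<bar>n \<bullet> f u\<bar> - n \<bullet> f u) *\<^sub>R n) has_derivative (\<lambda>v. ?D v + (0 - 0) *\<^sub>R n)) (at u)"
        by (intro has_derivative_add D has_derivative_scaleR_left has_derivative_diff g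
              has_derivative_abs_critical_zero equal)
      then show ?thesis by (auto simp: fold_across_def o_def)
    next
      case less
      have "open {u \<in> ball 0 1. n \<bullet> f u < 0}"
        using continuous_open_preimage[OF cont open_ball, of "{..<0}"] by (simp add: vimage_def Int_def)
      moreover have "((\<lambda>u. f u - (2 * (n \<bullet> f u)) *\<^sub>R n) has_derivative (\<lambda>v. ?D v - (2 * (n \<bullet> ?D v)) *\<^sub>R n)) (at u)"
        by (intro has_derivative_diff D has_derivative_scaleR_left has_derivative_mult_right has_derivative_inner_right)
      ultimately have "(?h has_derivative (\<lambda>v. ?D v - (2 * (n \<bullet> ?D v)) *\<^sub>R n)) (at u)"
        by (elim has_derivative_transform_within_open) (use u less in \<open>auto simp: fold_across_reflect\<close>)
      then show ?thesis
        using gram_isometry[OF linear_reflect norm_reflect[OF n]] by blast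
    next
      case greater
      have "open {u \<in> ball 0 1. n \<bullet> f u > 0}"
        using continuous_open_preimage[OF cont open_ball, of "{0<..}"] by (simp add: vimage_def Int_def)
      with D have "(?h has_derivative ?D) (at u)"
        by (elim has_derivative_transform_within_open) (use u greater in \<open>auto simp: fold_across_eq\<close>)
      then show ?thesis by blast
    qed
    then obtain D' where D': "(?h has_derivative D') (at u)" "gram (D' 1) (D' \<i>) = gram (?D 1) (?D \<i>)"
      by blast
    then show "?h differentiable (at u) \<and> jac ?h u = jac f u"
      using jac_has_derivative[OF D'(1)] jac_has_derivative[OF D] by (auto simp: differentiable_def)
  qed
qed

lemma spanning_disk_fold_across:
  assumes f: "spanning_disk \<Gamma> f" and n: "norm n = 1" and pos: "\<And>p. p \<in> \<Gamma> \<Longrightarrow> 0 \<le> n \<bullet> p"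
  shows "spanning_disk \<Gamma> (fold_across n \<circ> f)" "disk_area (fold_across n \<circ> f) = disk_area f"
proof -
  let ?h = "fold_across n \<circ> f"
  have lf: "lipschitz_disk f" and sph: "f ` cball 0 1 \<subseteq> sphere 0 1" and bij: "bij_betw f (sphere 0 1) \<Gamma>"
    using f by (auto simp: spanning_disk_iff)
  obtain L where "L-lipschitz_on (cball 0 1) f"
    using lf by (auto simp: lipschitz_disk_def)
  then have "(3 * L)-lipschitz_on (cball 0 1) ?h"
    by (intro lipschitz_on_compose lipschitz_fold_across n)
  moreover have "AE u in lebesgue. u \<in> ball 0 1 \<longrightarrow> ?h differentiable (at u)"
    using fold_across_jac[OF lf n] by eventually_elim auto
  ultimately have lh: "lipschitz_disk ?h" by (auto simp: lipschitz_disk_def)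
  have "bij_betw ?h (sphere 0 1) \<Gamma>"
    using bij bij_betwE[OF bij] by (subst bij_betw_cong[of _ _ f]) (auto simp: fold_across_eq pos)
  moreover have "?h ` cball 0 1 \<subseteq> sphere 0 1"
    using sph by (auto simp: norm_fold_across[OF n])
  ultimately show "spanning_disk \<Gamma> ?h"
    using lh by (simp add: spanning_disk_iff)
  have "AE u in lebesgue. u \<in> ball 0 1 \<longrightarrow> jac ?h u = jac f u"
    using fold_across_jac[OF lf n] by eventually_elim auto
  then show "disk_area ?h = disk_area f" by (rule disk_area_cong[OF lh lf])
qed

section \<open>Folding a disk into a thin sector\<close>

lemma lawson_polygon_iff:
  "p \<in> lawson_polygon g \<longleftrightarrow> (\<exists>t \<in> {0..pi/2}. \<exists>a \<in> {1, \<i>}. \<exists>b \<in> {1, cis (pi / (real g + 1))}.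
     p = (cos t *\<^sub>R a, sin t *\<^sub>R b))"
  unfolding lawson_polygon_def P_vertices_def Q_vertices_def quarter_arc_def by auto

definition sector :: "real \<Rightarrow> complex set" where
  "sector \<alpha> = {w. \<exists>r \<theta>. 0 \<le> r \<and> 0 \<le> \<theta> \<and> \<theta> \<le> \<alpha> \<and> w = r *\<^sub>R cis \<theta>}"

lemma upper_half_plane_sector: "0 \<le> Im w \<Longrightarrow> w \<in> sector pi"
proof -
  assume "0 \<le> Im w"
  then have "0 \<le> Arg w" using Arg_less_0 by force
  moreover have "w = cmod w *\<^sub>R cis (Arg w)"
    by (simp add: scaleR_conv_of_real rcis_cmod_Arg[unfolded rcis_def])
  ultimately show ?thesis
    unfolding sector_def using Arg_le_pi norm_ge_zero by blast
qed

text \<open>The vector -\<i> cis \<alpha> is the unit normal of the ray of angle \<alpha>, pointing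
  towards smaller angles. Reflection sends the angle \<theta> to 2 \<alpha> - \<theta>, which stays
  nonnegative since \<theta> exceeds \<alpha> by at most \<beta> \<le> \<alpha>.\<close>

lemma fold_across_sector:
  assumes w: "w \<in> sector (\<alpha> + \<beta>)" and "0 \<le> \<beta>" "\<beta> \<le> \<alpha>" "\<alpha> + \<beta> \<le> pi"
  shows "fold_across (- \<i> * cis \<alpha>) w \<in> sector \<alpha>"
proof -
  obtain r \<theta> where r: "0 \<le> r" "0 \<le> \<theta>" "\<theta> \<le> \<alpha> + \<beta>" "w = r *\<^sub>R cis \<theta>"
    using w by (auto simp: sector_def)
  have i: "(- \<i> * cis \<alpha>) \<bullet> w = r * sin (\<alpha> - \<theta>)"
    by (simp add: r inner_complex_def sin_diff algebra_simps)
  show ?thesis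
  proof (cases "\<theta> \<le> \<alpha>")
    case True
    have "0 \<le> sin (\<alpha> - \<theta>)" using True r assms by (intro sin_ge_zero) auto
    then have "fold_across (- \<i> * cis \<alpha>) w = w" using r(1) by (intro fold_across_eq) (simp only: i, simp)
    then show ?thesis using r True by (auto simp: sector_def)
  next
    case False
    have "0 \<le> sin (\<theta> - \<alpha>)" using False r assms by (intro sin_ge_zero) auto
    then have "sin (\<alpha> - \<theta>) \<le> 0" using sin_minus[of "\<theta> - \<alpha>"] by simp
    then have "fold_across (- \<i> * cis \<alpha>) w = w - (2 * (r * sin (\<alpha> - \<theta>))) *\<^sub>R (- \<i> * cis \<alpha>)"
      using r(1) fold_across_reflect[of "- \<i> * cis \<alpha>" w] unfolding i by (simp add: mult_nonneg_nonpos)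
    also have "\<dots> = r *\<^sub>R cis (2 * \<alpha> - \<theta>)"
    proof -
      have c: "cos (2 * \<alpha> - \<theta>) = cos \<theta> - 2 * sin (\<alpha> - \<theta>) * sin \<alpha>"
        using cos_add[of "\<alpha> - \<theta>" \<alpha>] cos_diff[of "\<alpha> - \<theta>" \<alpha>] by (simp add: algebra_simps)
      have s: "sin (2 * \<alpha> - \<theta>) = sin \<theta> + 2 * sin (\<alpha> - \<theta>) * cos \<alpha>"
        using sin_add[of "\<alpha> - \<theta>" \<alpha>] sin_diff[of "\<alpha> - \<theta>" \<alpha>] sin_minus[of \<theta>] by (simp add: algebra_simps)
      show ?thesis
        unfolding r(4) by (rule complex_eqI) (simp_all add: c s ring_distribs)
    qed
    finally show ?thesis
      unfolding sector_def using r False assms by (intro CollectI exI[of _ r] exI[of _ "2 * \<alpha> - \<theta>"]) auto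
  qed
qed

lemma fold_across_pair:
  "fold_across (n, 0) (z, w) = (fold_across n z, w)" "fold_across (0, m) (z, w) = (z, fold_across m w)"
  by (auto simp: fold_across_def)

text \<open>Folding across the ray of angle \<open>j * \<phi>\<close> for \<open>j = g, g - 1, \<dots>\<close> in turn keeps the argument
  nonnegative, because the part that sticks out is never wider than \<open>\<phi>\<close>.\<close>

lemma folded_spanning_disk:
  fixes g j :: nat
  assumes f: "spanning_disk (lawson_polygon g) f" and "j \<ge> 1" "j \<le> g + 1"
  defines "\<phi> \<equiv> pi / (real g + 1)"
  shows "\<exists>h. spanning_disk (lawson_polygon g) h \<and> disk_area h = disk_area f \<and>
    (\<forall>u. 0 \<le> Re (fst (h u)) \<and> 0 \<le> Im (fst (h u)) \<and> snd (h u) \<in> sector (real j * \<phi>))"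
  using \<open>j \<le> g + 1\<close> \<open>j \<ge> 1\<close>
proof (induction rule: inc_induct)
  case base
  \<comment> \<open>This is the case j = g + 1: three folds make Re z, Im z and Im w nonnegative,
    and the closed upper half-plane is the sector of angle (g + 1) \<phi> = pi.\<close>
  define h where "h = fold_across (0, \<i>) \<circ> (fold_across (\<i>, 0) \<circ> (fold_across (1, 0) \<circ> f))"
  have nn: "0 \<le> (1, 0) \<bullet> p \<and> 0 \<le> (\<i>, 0) \<bullet> p \<and> 0 \<le> (0, \<i>) \<bullet> p" if "p \<in> lawson_polygon g" for p
    using that sin_ge_zero[of "pi / (real g + 1)"] unfolding lawson_polygon_iff
    by (auto simp: inner_complex_def cos_ge_zero sin_ge_zero field_simps intro!: mult_nonneg_nonneg)
  have "spanning_disk (lawson_polygon g) h \<and> disk_area h = disk_area f"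
    unfolding h_def using nn f
    by (simp add: spanning_disk_fold_across[where \<Gamma> = "lawson_polygon g"] norm_Pair)
  moreover have "0 \<le> Re (fst (h u)) \<and> 0 \<le> Im (fst (h u)) \<and> 0 \<le> Im (snd (h u))" for u
    unfolding h_def by (cases "f u") (simp add: fold_across_pair, simp add: fold_across_def inner_complex_def)
  moreover have "real (g + 1) * \<phi> = pi" by (simp add: \<phi>_def field_simps)
  ultimately show ?case
    using upper_half_plane_sector by (intro exI[of _ h]) auto
next
  case (step j)
  then obtain h where h: "spanning_disk (lawson_polygon g) h" "disk_area h = disk_area f"
    "\<And>u. 0 \<le> Re (fst (h u)) \<and> 0 \<le> Im (fst (h u)) \<and> snd (h u) \<in> sector (real (Suc j) * \<phi>)" by auto
  define \<alpha> where "\<alpha> = j * \<phi>"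
  have \<phi>: "0 \<le> \<phi>" "\<phi> \<le> \<alpha>" "\<alpha> + \<phi> \<le> pi"
  proof -
    show "0 \<le> \<phi>" by (simp add: \<phi>_def)
    then show "\<phi> \<le> \<alpha>" using step.prems mult_right_mono[of 1 "real j" \<phi>] by (simp add: \<alpha>_def)
    have "real (Suc j) * \<phi> \<le> (real g + 1) * \<phi>" using step.hyps \<open>0 \<le> \<phi>\<close> by (intro mult_right_mono) auto
    moreover have "(real g + 1) * \<phi> = pi" by (simp add: \<phi>_def)
    ultimately show "\<alpha> + \<phi> \<le> pi" by (simp add: \<alpha>_def algebra_simps)
  qed
  \<comment> \<open>The wall at angle \<alpha> = j \<phi>. Since j \<ge> 1, the polygon angles 0 and
    \<phi> do not exceed \<alpha>, so the polygon lies on the positive side and is kept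
    fixed.\<close>
  let ?n = "(0 :: complex, - \<i> * cis \<alpha>)"
  have n: "norm ?n = 1" by (simp add: norm_Pair norm_mult)
  have nn: "0 \<le> ?n \<bullet> p" if p: "p \<in> lawson_polygon g" for p
  proof -
    obtain t a b where t: "t \<in> {0..pi/2}" "b \<in> {1, cis \<phi>}" "p = (cos t *\<^sub>R a, sin t *\<^sub>R b)"
      using p unfolding lawson_polygon_iff \<phi>_def by blast
    then obtain \<theta> where \<theta>: "b = cis \<theta>" "\<theta> \<in> {0, \<phi>}" by (metis cis_zero insertCI insertE singletonD)
    have "?n \<bullet> p = sin t * sin (\<alpha> - \<theta>)"
      by (simp add: t \<theta> inner_complex_def sin_diff algebra_simps)
    moreover have "0 \<le> sin t" using t by (intro sin_ge_zero) auto
    moreover have "0 \<le> sin (\<alpha> - \<theta>)" using \<theta> \<phi> by (intro sin_ge_zero) auto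
    ultimately show ?thesis by simp
  qed
  define k where "k = fold_across ?n \<circ> h"
  have "snd (k u) \<in> sector \<alpha>" for u
    using h(3)[of u] \<phi> fold_across_sector[of "snd (h u)" \<alpha> \<phi>]
    by (cases "h u") (simp add: k_def fold_across_pair \<alpha>_def algebra_simps)
  moreover have "fst (k u) = fst (h u)" for u
    by (cases "h u") (simp add: k_def fold_across_pair)
  moreover have "spanning_disk (lawson_polygon g) k" "disk_area k = disk_area f"
    using spanning_disk_fold_across[OF h(1) n nn] h(2) unfolding k_def by simp_all
  ultimately show ?case
    using h(3) unfolding \<alpha>_def by (intro exI[of _ k]) auto
qed

section \<open>Stretching the angle\<close>

text \<open>\<open>Arg\<close> jumps along the negative real axis, so the map is useful only on a
  sector that avoids this axis; this is why disks are folded first.\<close>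

definition stretch :: "real \<Rightarrow> complex \<Rightarrow> complex" where
  "stretch c w = cmod w *\<^sub>R cis (c * Arg w)"

lemma norm_stretch [simp]: "cmod (stretch c w) = cmod w"
  by (simp add: stretch_def)

lemma Arg_scaleR_cis:
  assumes "0 < r" "-pi < \<theta>" "\<theta> \<le> pi"
  shows "Arg (r *\<^sub>R cis \<theta>) = \<theta>"
  using assms by (intro cis_Arg_unique) (simp_all add: sgn_div_norm)

lemma stretch_scaleR_cis:
  assumes "0 \<le> r" "-pi < \<theta>" "\<theta> \<le> pi"
  shows "stretch c (r *\<^sub>R cis \<theta>) = r *\<^sub>R cis (c * \<theta>)"
  using assms by (cases "r = 0") (auto simp: stretch_def Arg_scaleR_cis)

lemma dist_cis: "cmod (cis x - cis y) = 2 * \<bar>sin ((x - y) / 2)\<bar>"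
proof -
  have "cis x - cis y = cis y * (exp (\<i> * of_real (x - y)) - 1)"
    by (simp only: cis_conv_exp[symmetric]) (simp add: right_diff_distrib cis_mult)
  then show ?thesis
    using dist_exp_i_1[of "x - y"] by (simp add: norm_mult)
qed

lemma dist_cis_le: "cmod (cis x - cis y) \<le> \<bar>x - y\<bar>"
  using abs_sin_x_le_abs_x[of "(x - y) / 2"] by (simp add: dist_cis)

text \<open>Half the difference t satisfies \<open>\<bar>t\<bar>\<close> \<le> pi/4, so cos t \<ge>
  1/2, and the tangent dominates its argument. The weaker bound pi/3 is used because its cosine is
  exactly 1/2.\<close>

lemma abs_le_dist_cis:
  assumes "\<bar>x - y\<bar> \<le> pi / 2"
  shows "\<bar>x - y\<bar> \<le> 2 * cmod (cis x - cis y)"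
proof -
  define t where "t = (x - y) / 2"
  have "\<bar>t\<bar> = \<bar>x - y\<bar> / 2" by (simp add: t_def)
  then have "4 * \<bar>t\<bar> \<le> pi" using assms by simp
  then have t: "\<bar>t\<bar> \<le> pi / 3" by simp
  then have c: "1 / 2 \<le> cos t"
    using cos_monotone_0_pi_le[of "\<bar>t\<bar>" "pi / 3"] by (simp add: cos_60)
  have "\<bar>t\<bar> * (1 / 2) \<le> \<bar>tan t\<bar> * cos t"
    using t c abs_tan_ge[of t] pi_gt_zero by (intro mult_mono) auto
  also have "\<dots> = \<bar>sin t\<bar>" using c by (simp add: tan_def)
  finally show ?thesis by (simp add: dist_cis t_def)
qed

text \<open>For r \<ge> s the images differ by a radial step r - s and a turn of length at most s c
  \<open>\<bar>a - b\<bar>\<close>. By the law of cosines both r - s and the chord s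
  \<open>cmod (cis a - cis b)\<close> are at most the original distance, and on a quarter plane the
  angle is at most twice its chord; this gives 1 + 2 c.\<close>

lemma lipschitz_stretch:
  assumes "0 \<le> c"
  shows "(1 + 2 * c)-lipschitz_on (sector (pi / 2)) (stretch c)"
proof (rule lipschitz_onI)
  have *: "cmod (stretch c (r *\<^sub>R cis a) - stretch c (s *\<^sub>R cis b)) \<le> (1 + 2 * c) * cmod (r *\<^sub>R cis a - s *\<^sub>R cis b)"
    if "0 \<le> s" "s \<le> r" "0 \<le> a" "a \<le> pi / 2" "0 \<le> b" "b \<le> pi / 2" for r s a b
  proof -
    let ?d = "cmod (r *\<^sub>R cis a - s *\<^sub>R cis b)"
    have rs: "r - s \<le> ?d"
      using norm_triangle_ineq2[of "r *\<^sub>R cis a" "s *\<^sub>R cis b"] that by simp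
    have "?d\<^sup>2 = (r - s)\<^sup>2 + r * s * (cmod (cis a - cis b))\<^sup>2"
    proof -
      show ?thesis
        unfolding cmod_power2
        by (simp add: power2_diff power_mult_distrib cos_squared_eq[of a] cos_squared_eq[of b] algebra_simps)
    qed
    moreover have "s\<^sup>2 * (cmod (cis a - cis b))\<^sup>2 \<le> r * s * (cmod (cis a - cis b))\<^sup>2"
      using that by (intro mult_right_mono) (auto simp: power2_eq_square intro: mult_right_mono)
    ultimately have "(s * cmod (cis a - cis b))\<^sup>2 \<le> ?d\<^sup>2"
      by (simp add: power_mult_distrib) (use zero_le_power2[of "r - s"] in linarith)
    then have sd: "s * cmod (cis a - cis b) \<le> ?d"
      by (rule power2_le_imp_le) simp
    have sab: "s * \<bar>a - b\<bar> \<le> 2 * ?d"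
    proof -
      have "a - b \<le> pi / 2" "b - a \<le> pi / 2" using that by linarith+
      then have "\<bar>a - b\<bar> \<le> pi / 2" by linarith
      then have "s * \<bar>a - b\<bar> \<le> s * (2 * cmod (cis a - cis b))"
        using that by (intro mult_left_mono abs_le_dist_cis)
      then show ?thesis using sd by simp
    qed
    have "-pi < a" "a \<le> pi" "-pi < b" "b \<le> pi"
      using that pi_gt_zero by linarith+
    then have "stretch c (r *\<^sub>R cis a) - stretch c (s *\<^sub>R cis b)
        = (r - s) *\<^sub>R cis (c * a) + s *\<^sub>R (cis (c * a) - cis (c * b))"
      using that by (simp add: stretch_scaleR_cis algebra_simps)
    then have "cmod (stretch c (r *\<^sub>R cis a) - stretch c (s *\<^sub>R cis b))
        \<le> cmod ((r - s) *\<^sub>R cis (c * a)) + cmod (s *\<^sub>R (cis (c * a) - cis (c * b)))"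
      by (metis norm_triangle_ineq)
    also have "\<dots> \<le> (r - s) + s * (c * \<bar>a - b\<bar>)"
    proof -
      have "cmod (cis (c * a) - cis (c * b)) \<le> c * \<bar>a - b\<bar>"
        using dist_cis_le[of "c * a" "c * b"] assms by (simp add: right_diff_distrib[symmetric] abs_mult)
      then show ?thesis using that by (simp add: mult_left_mono)
    qed
    also have "\<dots> \<le> ?d + c * (2 * ?d)"
      using rs mult_left_mono[OF sab assms] by (simp add: mult.left_commute)
    finally show ?thesis by (simp add: algebra_simps)
  qed
  fix v w assume "v \<in> sector (pi / 2)" "w \<in> sector (pi / 2)"
  then obtain r a s b where "0 \<le> s" "0 \<le> r" "0 \<le> a" "a \<le> pi / 2" "0 \<le> b" "b \<le> pi / 2"
    "v = r *\<^sub>R cis a" "w = s *\<^sub>R cis b"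
    unfolding sector_def by blast
  then show "dist (stretch c v) (stretch c w) \<le> (1 + 2 * c) * dist v w"
    using *[of s r a b] *[of r s b a] by (cases "s \<le> r") (simp_all add: dist_norm norm_minus_commute)
qed (use assms in auto)

text \<open>Off the cut the map is exp (Re (Ln w) + \<i> c Im (Ln w)). So it keeps the radial part
  of the logarithmic derivative v / w and multiplies the angular part by c.\<close>

lemma stretch_has_derivative:
  assumes w: "w \<notin> \<real>\<^sub>\<le>\<^sub>0"
  shows "(stretch c has_derivative (\<lambda>v. stretch c w * Complex (Re (v / w)) (c * Im (v / w)))) (at w)"
proof -
  have eq: "stretch c w = exp (Complex (Re (Ln w)) (c * Im (Ln w)))" if "w \<notin> \<real>\<^sub>\<le>\<^sub>0" for w
  proof -
    have "w \<noteq> 0" using that by auto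
    then show ?thesis
      by (simp add: stretch_def exp_eq_polar Arg_eq_Im_Ln scaleR_conv_of_real)
  qed
  have "(Ln has_derivative (\<lambda>v. inverse w * v)) (at w)"
    using has_field_derivative_Ln[OF w] by (simp add: has_field_derivative_def)
  then have "((\<lambda>w. Complex (Re (Ln w)) (c * Im (Ln w))) has_derivative
      (\<lambda>v. Complex (Re (inverse w * v)) (c * Im (inverse w * v)))) (at w)"
    unfolding Complex_eq
    by (intro has_derivative_add has_derivative_of_real has_derivative_mult_right
        has_derivative_Re has_derivative_Im)
  then have "((\<lambda>w. exp (Complex (Re (Ln w)) (c * Im (Ln w)))) has_derivative
      (\<lambda>v. exp (Complex (Re (Ln w)) (c * Im (Ln w))) * Complex (Re (inverse w * v)) (c * Im (inverse w * v)))) (at w)"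
    by (rule has_derivative_compose[OF _ DERIV_exp[THEN has_field_derivative_imp_has_derivative]])
  then have "(stretch c has_derivative
      (\<lambda>v. exp (Complex (Re (Ln w)) (c * Im (Ln w))) * Complex (Re (inverse w * v)) (c * Im (inverse w * v)))) (at w)"
    by (rule has_derivative_transform_within_open[OF _ open_Compl[OF closed_nonpos_Reals_complex]])
       (use w eq in auto)
  then show ?thesis using eq[OF w] by (simp add: divide_inverse mult.commute)
qed


section \<open>The area element in polar coordinates and under the stretch\<close>

lemma inner_mult_complex: "(w * a) \<bullet> (w * b) = (cmod w)\<^sup>2 * (a \<bullet> b)"
  unfolding inner_complex_def cmod_power2 by (simp add: algebra_simps power2_eq_square)

text \<open>Pythagoras for the wedge product of (h, s) and (k, t): the part inside the first factor
  is orthogonal to the part that involves the extra coordinate.\<close>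

lemma gram_orthogonal_split:
  fixes h k :: "'a::real_inner" and s t :: real
  shows "gram (h, s) (k, t) = gram h k + (norm (s *\<^sub>R k - t *\<^sub>R h))\<^sup>2"
proof -
  have "(norm (s *\<^sub>R k - t *\<^sub>R h))\<^sup>2 = s * s * (k \<bullet> k) - 2 * s * t * (h \<bullet> k) + t * t * (h \<bullet> h)"
    unfolding power2_norm_eq_inner
    by (simp add: inner_diff_left inner_diff_right inner_commute[of k h] algebra_simps)
  then show ?thesis
    by (simp add: gram_def power2_eq_square algebra_simps)
qed

text \<open>The component of a tangent vector \<open>(x, v)\<close> at \<open>(z, w)\<close> orthogonal to the rotation field
  \<open>(0, \<i> * w)\<close>, in coordinates.\<close>

definition horizontal :: "complex \<Rightarrow> complex \<times> complex \<Rightarrow> complex \<times> real" where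
  "horizontal w X = (fst X, cmod w * Re (snd X / w))"

definition angular :: "complex \<Rightarrow> complex \<times> complex \<Rightarrow> real" where
  "angular w X = cmod w * Im (snd X / w)"

lemma gram_polar:
  assumes "w \<noteq> 0"
  shows "gram X Y = gram (horizontal w X, angular w X) (horizontal w Y, angular w Y)"
proof -
  have "X \<bullet> Y = (horizontal w X, angular w X) \<bullet> (horizontal w Y, angular w Y)" for X Y
  proof -
    have "snd X \<bullet> snd Y = (cmod w)\<^sup>2 * ((snd X / w) \<bullet> (snd Y / w))"
      using assms by (simp flip: inner_mult_complex)
    then show ?thesis
      by (cases X; cases Y)
         (simp add: horizontal_def angular_def inner_complex_def power2_eq_square algebra_simps)
  qed
  then show ?thesis by (simp add: gram_def)
qed

text \<open>The derivative keeps horizontal parts and multiplies angular ones by c. With G the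
  horizontal Gram determinant and N the mixed term, the squared area element goes from G + N to G +
  c^2 N, which is at most c^2 (G + N); for c > 1 equality forces G = 0.\<close>

lemma stretch_jac:
  fixes f :: "complex \<Rightarrow> complex \<times> complex"
  assumes D: "(f has_derivative D) (at u)" and w: "snd (f u) \<notin> \<real>\<^sub>\<le>\<^sub>0" and c: "1 \<le> c"
  defines "h \<equiv> \<lambda>u. (fst (f u), stretch c (snd (f u)))"
  defines "H \<equiv> \<lambda>v. horizontal (snd (f u)) (D v)"
  shows "h differentiable (at u)" "jac h u \<le> c * jac f u"
    "c \<noteq> 1 \<Longrightarrow> jac h u = c * jac f u \<Longrightarrow> gram (H 1) (H \<i>) = 0"
proof -
  define w where "w = snd (f u)"
  define A where "A v = angular w (D v)" for v
  have "w \<noteq> 0" using assms(2) by (auto simp: w_def)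
  then have w0: "w \<noteq> 0" "stretch c w \<noteq> 0"
    using norm_stretch[of c w] by (metis norm_eq_zero)+
  define D' where "D' v = (fst (D v), stretch c w * Complex (Re (snd (D v) / w)) (c * Im (snd (D v) / w)))" for v
  have "(h has_derivative D') (at u)"
    unfolding h_def D'_def w_def
    by (intro has_derivative_Pair has_derivative_fst D has_derivative_compose[OF has_derivative_snd[OF D] stretch_has_derivative] w)
  then have jh: "jac h u = sqrt (gram (D' 1) (D' \<i>))" and "h differentiable (at u)"
    by (auto intro: jac_has_derivative simp: differentiable_def)
  then show "h differentiable (at u)" by blast
  have H': "horizontal (stretch c w) (D' v) = H v" "angular (stretch c w) (D' v) = c * A v" for v
    using w0 by (simp_all add: horizontal_def angular_def D'_def H_def A_def w_def)
  let ?N = "(norm (A 1 *\<^sub>R H \<i> - A \<i> *\<^sub>R H 1))\<^sup>2"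
  have "norm ((c * A 1) *\<^sub>R H \<i> - (c * A \<i>) *\<^sub>R H 1) = norm (c *\<^sub>R (A 1 *\<^sub>R H \<i> - A \<i> *\<^sub>R H 1))"
    by (simp add: scaleR_diff_right)
  then have g': "gram (D' 1) (D' \<i>) = gram (H 1) (H \<i>) + c\<^sup>2 * ?N"
    by (simp add: gram_polar[OF w0(2)] H' gram_orthogonal_split power_mult_distrib)
  have g: "gram (D 1) (D \<i>) = gram (H 1) (H \<i>) + ?N"
    by (simp add: gram_polar[OF w0(1)] gram_orthogonal_split H_def A_def w_def)
  have jf: "jac f u = sqrt (gram (D 1) (D \<i>))" by (rule jac_has_derivative[OF D])
  have cj: "c * jac f u = sqrt (c\<^sup>2 * gram (D 1) (D \<i>))"
    using c by (simp add: jf real_sqrt_mult)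
  have c2: "1 \<le> c\<^sup>2" using c by simp
  have "gram (D' 1) (D' \<i>) \<le> c\<^sup>2 * gram (D 1) (D \<i>)"
    unfolding g g' using mult_right_mono[OF c2 gram_nonneg[of "H 1" "H \<i>"]] by (simp add: algebra_simps)
  then show "jac h u \<le> c * jac f u" unfolding cj jh by simp
  assume "c \<noteq> 1" "jac h u = c * jac f u"
  then have "(c\<^sup>2 - 1) * gram (H 1) (H \<i>) = 0"
    unfolding cj jh g g' by (simp add: algebra_simps)
  moreover have "c\<^sup>2 \<noteq> 1" using c \<open>c \<noteq> 1\<close> by (simp add: power2_eq_1_iff)
  ultimately show "gram (H 1) (H \<i>) = 0" by simp
qed

text \<open>The stretch has no derivative at w = 0 in general, but it preserves the modulus, so a
  w-component with zero value and zero differential keeps both. Almost every point with w = 0 is of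
  this kind.\<close>

lemma stretch_jac_zero:
  fixes f :: "complex \<Rightarrow> complex \<times> complex" and c :: real
  assumes D: "(f has_derivative D) (at u)" and w: "snd (f u) = 0" "\<And>v. snd (D v) = 0"
  defines "h \<equiv> \<lambda>u. (fst (f u), stretch c (snd (f u)))"
  shows "h differentiable (at u)" "jac h u = jac f u"
proof -
  have "((\<lambda>u. snd (f u)) has_derivative (\<lambda>v. 0)) (at u)"
    using has_derivative_snd[OF D] w by simp
  then have "((\<lambda>u. stretch c (snd (f u))) has_derivative (\<lambda>v. 0)) (at u)"
    using w(1) by (simp add: has_derivative_at stretch_def[of c 0])
  then have "(h has_derivative (\<lambda>v. (fst (D v), 0))) (at u)"
    unfolding h_def by (intro has_derivative_Pair has_derivative_fst D)
  also have "(\<lambda>v. (fst (D v), 0)) = D" using w by (simp add: prod_eq_iff fun_eq_iff)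
  finally have h: "(h has_derivative D) (at u)" .
  then show "h differentiable (at u)" by (auto simp: differentiable_def)
  show "jac h u = jac f u" by (simp add: jac_has_derivative[OF h] jac_has_derivative[OF D])
qed

lemma sector_mono: "\<alpha> \<le> \<beta> \<Longrightarrow> sector \<alpha> \<subseteq> sector \<beta>"
  unfolding sector_def by (blast intro: order_trans)

lemma sector_not_nonpos_Real:
  assumes "w \<in> sector (pi / 2)" "w \<noteq> 0"
  shows "w \<notin> \<real>\<^sub>\<le>\<^sub>0"
proof
  assume "w \<in> \<real>\<^sub>\<le>\<^sub>0"
  then have w: "Re w \<le> 0" "Im w = 0" by (auto simp: complex_nonpos_Reals_iff)
  obtain r \<theta> where r: "0 \<le> r" "0 \<le> \<theta>" "\<theta> \<le> pi / 2" "w = r *\<^sub>R cis \<theta>"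
    using assms(1) by (auto simp: sector_def)
  have "0 \<le> cos \<theta>" using r by (intro cos_ge_zero) auto
  then have "0 \<le> Re w" using r by simp
  then show False using w assms(2) by (simp add: complex_eq_iff)
qed

lemma AE_snd_derivative_zero:
  fixes f :: "complex \<Rightarrow> complex \<times> complex"
  assumes f: "lipschitz_disk f"
  shows "AE u in lebesgue. u \<in> ball 0 1 \<longrightarrow> snd (f u) = 0 \<longrightarrow>
    (\<forall>v. snd (frechet_derivative f (at u) v) = 0)"
  using AE_derivative_zero_on_hyperplane[OF f, of "(0, 1)"] AE_derivative_zero_on_hyperplane[OF f, of "(0, \<i>)"]
proof eventually_elim
  case (elim u)
  then show ?case
    by (auto simp: inner_prod_def inner_complex_def complex_eq_iff)
qed

lemma bij_betw_stretch_lawson_polygon: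
  fixes g :: nat
  defines "c \<equiv> (real g + 2) / (real g + 1)"
  shows "bij_betw (\<lambda>p. (fst p, stretch c (snd p))) (lawson_polygon (Suc g)) (lawson_polygon g)"
proof -
  define \<phi> where "\<phi> = pi / (real g + 2)"
  have g: "real g + 1 \<noteq> 0" "real g + 2 \<noteq> 0" by linarith+
  have \<phi>: "0 < \<phi>" "\<phi> \<le> pi" "0 < c" by (auto simp: \<phi>_def c_def field_simps)
  have c\<phi>: "c * \<phi> = pi / (real g + 1)" "1 / c * (pi / (real g + 1)) = \<phi>"
    using g by (simp_all add: \<phi>_def c_def)
  have c\<phi>_le: "0 < pi / (real g + 1)" "pi / (real g + 1) \<le> pi" by (auto simp: field_simps)
  have st: "stretch c (sin t *\<^sub>R 1) = sin t *\<^sub>R 1" "stretch (1 / c) (sin t *\<^sub>R 1) = sin t *\<^sub>R 1"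
    "stretch c (sin t *\<^sub>R cis \<phi>) = sin t *\<^sub>R cis (pi / (real g + 1))"
    "stretch (1 / c) (sin t *\<^sub>R cis (pi / (real g + 1))) = sin t *\<^sub>R cis \<phi>"
    if "t \<in> {0..pi/2}" for t
  proof -
    have s: "0 \<le> sin t" using that by (intro sin_ge_zero) auto
    show "stretch c (sin t *\<^sub>R 1) = sin t *\<^sub>R 1" "stretch (1 / c) (sin t *\<^sub>R 1) = sin t *\<^sub>R 1"
      using stretch_scaleR_cis[OF s, of 0] by auto
    show "stretch c (sin t *\<^sub>R cis \<phi>) = sin t *\<^sub>R cis (pi / (real g + 1))"
      using stretch_scaleR_cis[OF s, of \<phi> c] \<phi> unfolding c\<phi> by auto
    show "stretch (1 / c) (sin t *\<^sub>R cis (pi / (real g + 1))) = sin t *\<^sub>R cis \<phi>"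
      using stretch_scaleR_cis[OF s, of "pi / (real g + 1)" "1 / c"] c\<phi>_le unfolding c\<phi> by auto
  qed
  have 1: "p \<in> lawson_polygon (Suc g) \<longleftrightarrow> (\<exists>t \<in> {0..pi/2}. \<exists>a \<in> {1, \<i>}. \<exists>b \<in> {1, cis \<phi>}.
     p = (cos t *\<^sub>R a, sin t *\<^sub>R b))" for p
    unfolding lawson_polygon_iff \<phi>_def by (simp add: add.commute)
  show ?thesis
  proof (rule bij_betw_byWitness[where f' = "\<lambda>p. (fst p, stretch (1 / c) (snd p))"])
    show "\<forall>p\<in>lawson_polygon (Suc g). (fst (fst p, stretch c (snd p)), stretch (1 / c) (snd (fst p, stretch c (snd p)))) = p"
    proof
      fix p assume "p \<in> lawson_polygon (Suc g)"
      then obtain t b where t: "t \<in> {0..pi/2}" "b \<in> {1, cis \<phi>}" "snd p = sin t *\<^sub>R b"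
        unfolding 1 by (metis snd_conv)
      then have "stretch (1 / c) (stretch c (snd p)) = snd p" using st[OF t(1)] by (auto simp del: scaleR_conv_of_real)
      then show "(fst (fst p, stretch c (snd p)), stretch (1 / c) (snd (fst p, stretch c (snd p)))) = p"
        by (simp add: prod_eq_iff)
    qed
    show "\<forall>p\<in>lawson_polygon g. (fst (fst p, stretch (1 / c) (snd p)), stretch c (snd (fst p, stretch (1 / c) (snd p)))) = p"
    proof
      fix p assume "p \<in> lawson_polygon g"
      then obtain t b where t: "t \<in> {0..pi/2}" "b \<in> {1, cis (pi / (real g + 1))}" "snd p = sin t *\<^sub>R b"
        unfolding lawson_polygon_iff by (metis snd_conv)
      then have "stretch c (stretch (1 / c) (snd p)) = snd p" using st[OF t(1)] by (auto simp del: scaleR_conv_of_real)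
      then show "(fst (fst p, stretch (1 / c) (snd p)), stretch c (snd (fst p, stretch (1 / c) (snd p)))) = p"
        by (simp add: prod_eq_iff)
    qed
    show "(\<lambda>p. (fst p, stretch c (snd p))) ` lawson_polygon (Suc g) \<subseteq> lawson_polygon g"
    proof clarify
      fix z w assume "(z, w) \<in> lawson_polygon (Suc g)"
      then obtain t a b where t: "t \<in> {0..pi/2}" "a \<in> {1, \<i>}" "b \<in> {1, cis \<phi>}" "z = cos t *\<^sub>R a" "w = sin t *\<^sub>R b"
        unfolding 1 by blast
      then show "(fst (z, w), stretch c (snd (z, w))) \<in> lawson_polygon g"
        unfolding lawson_polygon_iff using st[OF t(1)] by (intro bexI[OF _ t(1)] bexI[OF _ t(2)]) (auto simp del: scaleR_conv_of_real)
    qed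
    show "(\<lambda>p. (fst p, stretch (1 / c) (snd p))) ` lawson_polygon g \<subseteq> lawson_polygon (Suc g)"
    proof clarify
      fix z w assume "(z, w) \<in> lawson_polygon g"
      then obtain t a b where t: "t \<in> {0..pi/2}" "a \<in> {1, \<i>}" "b \<in> {1, cis (pi / (real g + 1))}"
        "z = cos t *\<^sub>R a" "w = sin t *\<^sub>R b"
        unfolding lawson_polygon_iff by blast
      then show "(fst (z, w), stretch (1 / c) (snd (z, w))) \<in> lawson_polygon (Suc g)"
        unfolding 1 using st[OF t(1)] by (intro bexI[OF _ t(1)] bexI[OF _ t(2)]) (auto simp del: scaleR_conv_of_real)
    qed
  qed
qed

lemma stretched_spanning_disk:
  fixes g :: nat and f :: "complex \<Rightarrow> complex \<times> complex"
  assumes f: "spanning_disk (lawson_polygon (Suc g)) f"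
    and sec: "\<And>u. snd (f u) \<in> sector (pi / (real g + 2))"
  defines "c \<equiv> (real g + 2) / (real g + 1)"
  defines "h \<equiv> \<lambda>u. (fst (f u), stretch c (snd (f u)))"
  shows "spanning_disk (lawson_polygon g) h"
    and "AE u in lebesgue. u \<in> ball 0 1 \<longrightarrow> jac h u \<le> c * jac f u"
    and "AE u in lebesgue. u \<in> ball 0 1 \<longrightarrow> jac h u = c * jac f u \<longrightarrow>
      jac f u = 0 \<or> snd (f u) \<noteq> 0 \<and>
        gram (horizontal (snd (f u)) (frechet_derivative f (at u) 1))
             (horizontal (snd (f u)) (frechet_derivative f (at u) \<i>)) = 0"
proof -
  have lf: "lipschitz_disk f" and sph: "f ` cball 0 1 \<subseteq> sphere 0 1"
    and bij: "bij_betw f (sphere 0 1) (lawson_polygon (Suc g))"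
    using f by (auto simp: spanning_disk_iff)
  have c: "1 < c" by (simp add: c_def)
  \<comment> \<open>Even for g = 0 the sector is at most a quarter plane, which avoids the branch
    cut and allows the Lipschitz bound.\<close>
  have "pi / (real g + 2) \<le> pi / 2" by (intro divide_left_mono) auto
  then have sec2: "snd (f u) \<in> sector (pi / 2)" for u
    using sec[of u] sector_mono by blast
  have main: "AE u in lebesgue. u \<in> ball 0 1 \<longrightarrow> h differentiable (at u) \<and> jac h u \<le> c * jac f u \<and>
      (jac h u = c * jac f u \<longrightarrow> jac f u = 0 \<or> snd (f u) \<noteq> 0 \<and>
        gram (horizontal (snd (f u)) (frechet_derivative f (at u) 1))
             (horizontal (snd (f u)) (frechet_derivative f (at u) \<i>)) = 0)"
    using lipschitz_diskD(2)[OF lf] AE_snd_derivative_zero[OF lf]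
  proof eventually_elim
    case (elim u)
    show ?case
    proof
      assume u: "u \<in> ball 0 1"
      let ?D = "frechet_derivative f (at u)"
      have D: "(f has_derivative ?D) (at u)" using elim u by blast
      show "h differentiable (at u) \<and> jac h u \<le> c * jac f u \<and>
        (jac h u = c * jac f u \<longrightarrow> jac f u = 0 \<or> snd (f u) \<noteq> 0 \<and>
          gram (horizontal (snd (f u)) (?D 1)) (horizontal (snd (f u)) (?D \<i>)) = 0)"
      proof (cases "snd (f u) = 0")
        case True
        then have "h differentiable (at u)" "jac h u = jac f u"
          using stretch_jac_zero[OF D True, of c] elim u unfolding h_def by blast+
        \<comment> \<open>Here equality would read \<open>jac f u = c * jac f u\<close> with c > 1,
          so the area element is 0.\<close>
        then show ?thesis using c jac_nonneg[of f u] by (auto simp: mult_le_cancel_right1)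
      next
        case False
        then have "snd (f u) \<notin> \<real>\<^sub>\<le>\<^sub>0" by (rule sector_not_nonpos_Real[OF sec2])
        then show ?thesis using stretch_jac[OF D _ less_imp_le[OF c]] c False unfolding h_def by blast
      qed
    qed
  qed
  obtain L where L: "L-lipschitz_on (cball 0 1) f"
    using lf by (auto simp: lipschitz_disk_def)
  have Ls: "L-lipschitz_on (cball 0 1) (\<lambda>u. snd (f u))" and Lf: "L-lipschitz_on (cball 0 1) (\<lambda>u. fst (f u))"
    using L order_trans[OF dist_snd_le] order_trans[OF dist_fst_le] unfolding lipschitz_on_def by blast+
  have "(1 + 2 * c)-lipschitz_on ((\<lambda>u. snd (f u)) ` cball 0 1) (stretch c)"
    by (rule lipschitz_on_subset[OF lipschitz_stretch]) (use c sec2 in auto)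
  then have "\<exists>M. M-lipschitz_on (cball 0 1) h"
    unfolding h_def using lipschitz_on_Pair[OF Lf lipschitz_on_compose2[OF Ls]] by blast
  moreover have "AE u in lebesgue. u \<in> ball 0 1 \<longrightarrow> h differentiable (at u)"
    using main by eventually_elim blast
  ultimately have lh: "lipschitz_disk h" by (simp add: lipschitz_disk_def)
  have h: "h = (\<lambda>p. (fst p, stretch c (snd p))) \<circ> f" by (auto simp: h_def)
  have "bij_betw h (sphere 0 1) (lawson_polygon g)"
    unfolding h c_def by (rule bij_betw_trans[OF bij bij_betw_stretch_lawson_polygon])
  moreover have "norm (h u) = norm (f u)" for u
    by (cases "f u") (simp add: h_def norm_Pair)
  ultimately show "spanning_disk (lawson_polygon g) h"
    using lh sph by (auto simp: spanning_disk_iff)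
  show "AE u in lebesgue. u \<in> ball 0 1 \<longrightarrow> jac h u \<le> c * jac f u"
    using main by eventually_elim blast
  show "AE u in lebesgue. u \<in> ball 0 1 \<longrightarrow> jac h u = c * jac f u \<longrightarrow>
      jac f u = 0 \<or> snd (f u) \<noteq> 0 \<and>
        gram (horizontal (snd (f u)) (frechet_derivative f (at u) 1))
             (horizontal (snd (f u)) (frechet_derivative f (at u) \<i>)) = 0"
    using main by eventually_elim blast
qed

section \<open>The area-decreasing variation\<close>

text \<open>For w of modulus r and angle \<theta> this is r sin \<theta> times r sin (\<phi> -
  \<theta>), the product of the signed distances from the two lines that carry the boundary rays of
  the sector.\<close>

definition bump :: "real \<Rightarrow> complex \<Rightarrow> real" where
  "bump \<phi> w = Im w * Im (cis \<phi> * cnj w)"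

text \<open>The first factor vanishes on the polygon. The second is tangent to the sphere and vanishes where
  \<open>w = 0\<close>; the factor \<open>(cmod w)\<^sup>2\<close> in its first component removes from the tangential part of the constant
  field \<open>1 + \<i>\<close> the rotation in the \<open>z\<close>-plane, which does not vanish there.\<close>

definition shear :: "real \<Rightarrow> complex \<times> complex \<Rightarrow> complex \<times> complex" where
  "shear \<phi> p = bump \<phi> (snd p) *\<^sub>R
     ((snd p \<bullet> snd p) *\<^sub>R (1 + \<i>), - ((1 + \<i>) \<bullet> fst p) *\<^sub>R snd p)"

definition shear_deriv :: "real \<Rightarrow> complex \<times> complex \<Rightarrow> complex \<times> complex \<Rightarrow> complex \<times> complex" where
  "shear_deriv \<phi> p x =
     bump \<phi> (snd p) *\<^sub>R ((2 * (snd p \<bullet> snd x)) *\<^sub>R (1 + \<i>),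
       - ((1 + \<i>) \<bullet> fst x) *\<^sub>R snd p - ((1 + \<i>) \<bullet> fst p) *\<^sub>R snd x)
     + (Im (snd x) * Im (cis \<phi> * cnj (snd p)) + Im (snd p) * Im (cis \<phi> * cnj (snd x))) *\<^sub>R
       ((snd p \<bullet> snd p) *\<^sub>R (1 + \<i>), - ((1 + \<i>) \<bullet> fst p) *\<^sub>R snd p)"

lemma shear_has_derivative: "(shear \<phi> has_derivative shear_deriv \<phi> p) (at p within S)"
proof -
  have b: "((\<lambda>p. bump \<phi> (snd p)) has_derivative
      (\<lambda>x. Im (snd x) * Im (cis \<phi> * cnj (snd p)) + Im (snd p) * Im (cis \<phi> * cnj (snd x)))) (at p within S)"
    unfolding bump_def by (auto intro!: derivative_eq_intros)
  have q: "((\<lambda>p. ((snd p \<bullet> snd p) *\<^sub>R (1 + \<i>), - ((1 + \<i>) \<bullet> fst p) *\<^sub>R snd p)) has_derivative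
      (\<lambda>x. ((2 * (snd p \<bullet> snd x)) *\<^sub>R (1 + \<i>),
       - ((1 + \<i>) \<bullet> fst x) *\<^sub>R snd p - ((1 + \<i>) \<bullet> fst p) *\<^sub>R snd x))) (at p within S)"
    by (rule has_derivative_Pair) (auto intro!: derivative_eq_intros simp: inner_commute algebra_simps)
  have "(shear \<phi> has_derivative (\<lambda>x. bump \<phi> (snd p) *\<^sub>R ((2 * (snd p \<bullet> snd x)) *\<^sub>R (1 + \<i>),
       - ((1 + \<i>) \<bullet> fst x) *\<^sub>R snd p - ((1 + \<i>) \<bullet> fst p) *\<^sub>R snd x)
     + (Im (snd x) * Im (cis \<phi> * cnj (snd p)) + Im (snd p) * Im (cis \<phi> * cnj (snd x))) *\<^sub>R
       ((snd p \<bullet> snd p) *\<^sub>R (1 + \<i>), - ((1 + \<i>) \<bullet> fst p) *\<^sub>R snd p))) (at p within S)"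
    using has_derivative_scaleR[OF b q] unfolding shear_def .
  then show ?thesis unfolding shear_deriv_def .
qed

lemma linear_shear_deriv: "linear (shear_deriv \<phi> p)"
  using has_derivative_linear[OF shear_has_derivative] .

text \<open>Compactness bounds the expression for p and x in the unit balls; linearity in x extends
  the bound to all x.\<close>

lemma shear_deriv_bound:
  obtains C where "0 < C" "\<And>p x. norm p \<le> 1 \<Longrightarrow> norm (shear_deriv \<phi> p x) \<le> C * norm x"
proof -
  have "continuous_on (cball 0 1 \<times> cball 0 1) (\<lambda>(p, x). shear_deriv \<phi> p x)"
    unfolding shear_deriv_def bump_def case_prod_unfold by (intro continuous_intros)
  then have "bounded ((\<lambda>(p, x). shear_deriv \<phi> p x) ` (cball 0 1 \<times> cball 0 1))"
    by (intro compact_imp_bounded compact_continuous_image compact_Times) auto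
  then obtain C where C: "0 < C" "\<And>p x. norm p \<le> 1 \<Longrightarrow> norm x \<le> 1 \<Longrightarrow> norm (shear_deriv \<phi> p x) \<le> C"
    unfolding bounded_pos by force
  have "norm (shear_deriv \<phi> p x) \<le> C * norm x" if "norm p \<le> 1" for p x
  proof (cases "x = 0")
    case True
    then show ?thesis by (simp add: linear_0[OF linear_shear_deriv])
  next
    case False
    have "shear_deriv \<phi> p x = norm x *\<^sub>R shear_deriv \<phi> p (x /\<^sub>R norm x)"
      using False by (simp flip: linear_scale[OF linear_shear_deriv])
    then have "norm (shear_deriv \<phi> p x) = norm x * norm (shear_deriv \<phi> p (x /\<^sub>R norm x))"
      by (metis abs_norm_cancel norm_scaleR)
    also have "\<dots> \<le> norm x * C" using False that by (intro mult_left_mono C) auto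
    finally show ?thesis by (simp add: mult.commute)
  qed
  then show ?thesis using C(1) that by blast
qed

lemma shear_orthogonal: "p \<bullet> shear \<phi> p = 0"
  by (cases p) (simp add: shear_def inner_commute algebra_simps)

text \<open>The displacement is tangent to the sphere through p, so a point of the unit sphere never
  moves inside it. Hence the radial projection back onto the sphere does not increase area.\<close>

lemma norm_add_shear_ge: "norm p \<le> norm (p + t *\<^sub>R shear \<phi> p)"
proof -
  have "(norm (p + t *\<^sub>R shear \<phi> p))\<^sup>2 = (norm p)\<^sup>2 + (norm (t *\<^sub>R shear \<phi> p))\<^sup>2"
    by (rule norm_add_Pythagorean) (simp add: orthogonal_def shear_orthogonal)
  then have "(norm p)\<^sup>2 \<le> (norm (p + t *\<^sub>R shear \<phi> p))\<^sup>2" by simp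
  then show ?thesis by (rule power2_le_imp_le) simp
qed

lemma shear_lawson_polygon:
  assumes "p \<in> lawson_polygon g"
  shows "shear (pi / (real g + 1)) p = 0"
proof -
  have "bump (pi / (real g + 1)) (snd p) = 0"
    using assms unfolding lawson_polygon_iff by (auto simp: bump_def)
  then show ?thesis by (simp add: shear_def zero_prod_def)
qed

text \<open>The trace of \<open>shear_deriv\<close> over the plane spanned by the horizontal unit vector
  \<open>(v, s *\<^sub>R w)\<close> and the rotation field: minus the rate at which shearing decreases area.\<close>

lemma shear_trace_le:
  assumes p: "norm (z, w) = 1" and w: "w \<noteq> 0" and z: "0 \<le> Re z" "0 \<le> Im z" and m: "0 \<le> bump \<phi> w"
    and e: "norm (v, s *\<^sub>R w) = 1" "(z, w) \<bullet> (v, s *\<^sub>R w) = 0"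
  defines "e \<equiv> (v, s *\<^sub>R w)" and "e' \<equiv> (0, (1 / cmod w) *\<^sub>R (\<i> * w))"
  shows "e \<bullet> shear_deriv \<phi> (z, w) e + e' \<bullet> shear_deriv \<phi> (z, w) e'
    \<le> - (bump \<phi> w * ((1 + \<i>) \<bullet> z)) / 4"
proof -
  define a :: complex where "a = 1 + \<i>"
  define k where "k = a \<bullet> z"
  define A where "A = a \<bullet> v"
  define r where "r = w \<bullet> w"
  define m where "m = bump \<phi> w"
  have r0: "r \<noteq> 0" "r = (cmod w)\<^sup>2" using w by (simp_all add: r_def power2_norm_eq_inner)
  have iw: "w \<bullet> (\<i> * w) = 0" "(\<i> * w) \<bullet> w = 0" "(\<i> * w) \<bullet> (\<i> * w) = r"
    by (simp_all add: inner_complex_def r_def)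
  have dm: "Im (s *\<^sub>R w) * Im (cis \<phi> * cnj w) + Im w * Im (cis \<phi> * cnj (s *\<^sub>R w)) = 2 * s * m"
    by (simp add: m_def bump_def algebra_simps)
  have sd: "shear_deriv \<phi> (z, w) (x, y) =
      (m *\<^sub>R ((2 * (w \<bullet> y)) *\<^sub>R a) + d *\<^sub>R (r *\<^sub>R a), m *\<^sub>R (- (a \<bullet> x) *\<^sub>R w - k *\<^sub>R y) + d *\<^sub>R (- k *\<^sub>R w))"
    if "d = Im y * Im (cis \<phi> * cnj w) + Im w * Im (cis \<phi> * cnj y)" for x y d
    unfolding shear_deriv_def that m_def k_def r_def a_def by (simp only: fst_conv snd_conv scaleR_Pair add_Pair)
  have va: "v \<bullet> (a * 2) = A * 2"
    by (simp add: A_def inner_complex_def)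
  \<comment> \<open>The first component contributes 4 s r A, half of it from differentiating
    \<open>bump\<close>; the second contributes - s r A and the three terms - k s^2 r.\<close>
  have e1: "e \<bullet> shear_deriv \<phi> (z, w) e = m * (3 * s * r * A - 3 * k * s\<^sup>2 * r)"
    unfolding e_def sd[OF dm[symmetric]] inner_Pair
    by (simp add: inner_add_right inner_diff_right va inner_commute[of v a] A_def[symmetric] r_def[symmetric]
        power2_eq_square algebra_simps)
  have "e' \<bullet> shear_deriv \<phi> (z, w) e' = - (m * k * (r / (cmod w)\<^sup>2))"
    unfolding e'_def sd[OF refl] inner_Pair
    by (simp add: inner_add_right inner_diff_right iw power2_eq_square)
  then have e2: "e' \<bullet> shear_deriv \<phi> (z, w) e' = - m * k"
    using r0 by simp
  have zv: "s * r = - (z \<bullet> v)" using e(2) by (simp add: r_def)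
  have vs: "v \<bullet> v + s\<^sup>2 * r = 1"
    using e(1) by (simp add: norm_eq_1 r_def power2_eq_square algebra_simps)
  have k: "k = Re z + Im z" "A = Re v + Im v" by (simp_all add: k_def A_def a_def inner_complex_def)
  \<comment> \<open>Four times the difference of the two sides is linear in z. The coefficients of
    Re z and Im z are sums of two squares, and both coordinates are nonnegative.\<close>
  have q: "- (z \<bullet> v) * A \<le> k * (v \<bullet> v) / 4"
  proof -
    have "0 \<le> (2 * Re v + Im v)\<^sup>2 + (Re v)\<^sup>2" "0 \<le> (2 * Im v + Re v)\<^sup>2 + (Im v)\<^sup>2" by simp_all
    then have "0 \<le> Re z * ((2 * Re v + Im v)\<^sup>2 + (Re v)\<^sup>2) + Im z * ((2 * Im v + Re v)\<^sup>2 + (Im v)\<^sup>2)"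
      using z by simp
    also have "\<dots> = 4 * (z \<bullet> v * A + k * (v \<bullet> v) / 4)"
      unfolding k inner_complex_def by (simp add: power2_eq_square algebra_simps)
    finally show ?thesis by simp
  qed
  have "3 * s * r * A - 3 * k * s\<^sup>2 * r - k = 3 * (- (z \<bullet> v) * A) - 3 * k * (s\<^sup>2 * r) - k"
    by (simp add: zv[symmetric])
  also have "\<dots> \<le> 3 * (k * (v \<bullet> v) / 4) - 3 * k * (s\<^sup>2 * r) - k"
    using q by (simp add: algebra_simps)
  \<comment> \<open>Uses v \<bullet> v = 1 - s^2 r. The horizontal direction can cost at most 3/4 k
    while the rotation direction gains k; the constant 1/4 is what remains.\<close>
  also have "\<dots> = - k / 4 - 15 / 4 * k * (s\<^sup>2 * r)"
    using vs by (simp add: algebra_simps) algebra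
  also have "\<dots> \<le> - k / 4"
  proof -
    have "0 \<le> k * (s\<^sup>2 * r)" using z by (simp add: k r_def)
    then show ?thesis by (simp add: mult_ac)
  qed
  finally have "m * (3 * s * r * A - 3 * k * s\<^sup>2 * r - k) \<le> m * (- k / 4)"
    using m by (intro mult_left_mono) (auto simp: m_def)
  then show ?thesis unfolding e1 e2 by (simp add: m_def k_def a_def algebra_simps)
qed


lemma linear_id_add_shear_deriv: "linear (\<lambda>x. x + t *\<^sub>R shear_deriv \<phi> p x)"
  by (intro linearI) (simp_all add: linear_add[OF linear_shear_deriv] linear_scale[OF linear_shear_deriv] algebra_simps)

text \<open>Unless X and Y are dependent, they span the plane of the orthonormal pair
  \<open>e\<close>, \<open>e'\<close> (horizontal and rotation direction), because their horizontal
  parts are parallel. In this basis the sheared area is at most a product of two lengths, hence half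
  the sum of their squares, whose term linear in t is the trace bounded in
  \<open>shear_trace_le\<close>.\<close>

lemma gram_shear_le:
  assumes p: "norm (z, w) = 1" and w: "w \<noteq> 0" and z: "0 \<le> Re z" "0 \<le> Im z" and m: "0 \<le> bump \<phi> w"
    and X: "(z, w) \<bullet> X = 0" and Y: "(z, w) \<bullet> Y = 0"
    and vert: "gram (horizontal w X) (horizontal w Y) = 0"
    and C: "\<And>x. norm (shear_deriv \<phi> (z, w) x) \<le> C * norm x" and t: "0 \<le> t"
  shows "sqrt (gram (X + t *\<^sub>R shear_deriv \<phi> (z, w) X) (Y + t *\<^sub>R shear_deriv \<phi> (z, w) Y))
    \<le> (1 - t * (bump \<phi> w * ((1 + \<i>) \<bullet> z) / 4) + t\<^sup>2 * C\<^sup>2) * sqrt (gram X Y)"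
proof (cases "gram X Y = 0")
  case True
  then show ?thesis using gram_linear_eq_0[OF linear_id_add_shear_deriv True] by simp
next
  case False
  let ?S = "shear_deriv \<phi> (z, w)"
  define B where "B x = x + t *\<^sub>R ?S x" for x
  have linB: "linear B"
    unfolding B_def by (rule linear_id_add_shear_deriv)
  define e' where "e' = (0 :: complex, (1 / cmod w) *\<^sub>R (\<i> * w))"
  have "horizontal w X \<noteq> 0 \<or> horizontal w Y \<noteq> 0"
    using False vert by (auto simp: gram_polar[OF w, of X Y] gram_orthogonal_split)
  then obtain h a b where h: "norm h = 1" "horizontal w X = a *\<^sub>R h" "horizontal w Y = b *\<^sub>R h"
    using gram_eq_0_imp_parallel[OF vert] by metis
  define s where "s = snd h / cmod w"
  define e where "e = (fst h, s *\<^sub>R w)"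
  have dec: "Z = c *\<^sub>R e + angular w Z *\<^sub>R e'" if "horizontal w Z = c *\<^sub>R h" for Z c
  proof -
    have "fst Z = c *\<^sub>R fst h" and re: "Re (snd Z / w) = c * s"
      using arg_cong[OF that, of fst] arg_cong[OF that, of snd] w
      by (simp_all add: horizontal_def s_def field_simps)
    moreover have "snd Z = w * Complex (c * s) (angular w Z / cmod w)"
      using w by (simp add: re[symmetric] angular_def)
    ultimately show ?thesis
      by (cases Z) (simp add: e_def e'_def complex_eq_iff algebra_simps)
  qed
  define x y where "x = angular w X" and "y = angular w Y"
  have XY: "X = a *\<^sub>R e + x *\<^sub>R e'" "Y = b *\<^sub>R e + y *\<^sub>R e'"
    using dec h x_def y_def by blast+
  have "norm e = norm h"
    using w by (cases h) (simp add: e_def s_def norm_Pair)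
  then have ne: "norm e = 1" using h by simp
  have ne': "norm e' = 1" using w by (simp add: e'_def norm_Pair norm_mult)
  have ee': "e \<bullet> e' = 0" by (simp add: e_def e'_def inner_complex_def)
  have gXY: "gram X Y = (a * y - x * b)\<^sup>2"
    unfolding XY gram_linear_combination
    using ne ne' ee' by (simp add: gram_def norm_eq_1)
  have "(z, w) \<bullet> e' = 0" by (simp add: e'_def inner_complex_def)
  \<comment> \<open>Tangency passes from X, Y and \<open>e'\<close> to \<open>e\<close>, since a and
    b are not both 0.\<close>
  then have "a * ((z, w) \<bullet> e) = 0" "b * ((z, w) \<bullet> e) = 0"
    using X Y unfolding XY by (simp_all add: inner_add_right del: inner_Pair)
  moreover have "a \<noteq> 0 \<or> b \<noteq> 0" using False gXY by auto
  ultimately have pe: "(z, w) \<bullet> e = 0" by auto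
  have tr: "e \<bullet> ?S e + e' \<bullet> ?S e' \<le> - (bump \<phi> w * ((1 + \<i>) \<bullet> z)) / 4"
    unfolding e_def e'_def using shear_trace_le[OF p w z m] ne pe unfolding e_def by blast
  have nB: "(norm (B x))\<^sup>2 \<le> 1 + 2 * t * (x \<bullet> ?S x) + t\<^sup>2 * C\<^sup>2" if "norm x = 1" for x
  proof -
    have "(norm (B x))\<^sup>2 = x \<bullet> x + 2 * t * (x \<bullet> ?S x) + t\<^sup>2 * (?S x \<bullet> ?S x)"
      unfolding power2_norm_eq_inner B_def
      by (simp add: inner_add_left inner_add_right inner_commute[of "?S x" x] power2_eq_square algebra_simps)
    moreover have "?S x \<bullet> ?S x \<le> C\<^sup>2"
      using C[of x] that by (simp flip: power2_norm_eq_inner add: power_mono)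
    ultimately show ?thesis using that by (simp add: norm_eq_1 mult_left_mono)
  qed
  have "sqrt (gram (B X) (B Y)) = \<bar>a * y - x * b\<bar> * sqrt (gram (B e) (B e'))"
    unfolding XY by (simp add: linear_add[OF linB] linear_scale[OF linB] gram_linear_combination real_sqrt_mult)
  also have "\<dots> \<le> \<bar>a * y - x * b\<bar> * (1 - t * (bump \<phi> w * ((1 + \<i>) \<bullet> z) / 4) + t\<^sup>2 * C\<^sup>2)"
  proof (rule mult_left_mono)
    have "sqrt (gram (B e) (B e')) \<le> sqrt ((norm (B e))\<^sup>2 * (norm (B e'))\<^sup>2)"
      by (intro real_sqrt_le_mono gram_le)
    also have "\<dots> = norm (B e) * norm (B e')" by (simp add: real_sqrt_mult)
    also have "\<dots> \<le> ((norm (B e))\<^sup>2 + (norm (B e'))\<^sup>2) / 2"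
      using zero_le_power2[of "norm (B e) - norm (B e')"] by (simp add: power2_diff)
    also have "\<dots> \<le> 1 + t * (e \<bullet> ?S e + e' \<bullet> ?S e') + t\<^sup>2 * C\<^sup>2"
      using nB[OF ne] nB[OF ne'] by (simp add: algebra_simps)
    also have "\<dots> \<le> 1 - t * (bump \<phi> w * ((1 + \<i>) \<bullet> z) / 4) + t\<^sup>2 * C\<^sup>2"
      using mult_left_mono[OF tr t] by simp
    finally show "sqrt (gram (B e) (B e')) \<le> 1 - t * (bump \<phi> w * ((1 + \<i>) \<bullet> z) / 4) + t\<^sup>2 * C\<^sup>2" .
  qed simp
  also have "\<bar>a * y - x * b\<bar> = sqrt (gram X Y)" by (simp add: gXY)
  finally show ?thesis unfolding B_def by (simp add: mult.commute)
qed

section \<open>Projection back to the sphere and the sheared competitors\<close>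

definition radial :: "'a::real_normed_vector \<Rightarrow> 'a" where
  "radial q = q /\<^sub>R norm q"

lemma lipschitz_radial: "2-lipschitz_on {q. 1 \<le> norm q} (radial :: 'a::real_normed_vector \<Rightarrow> 'a)"
proof (rule lipschitz_onI)
  fix x y :: 'a assume "x \<in> {q. 1 \<le> norm q}" "y \<in> {q. 1 \<le> norm q}"
  then have x: "1 \<le> norm x" and y: "1 \<le> norm y" by auto
  have "x \<noteq> 0" "y \<noteq> 0" using x y by auto
  then have "radial x - radial y = (1 / norm x) *\<^sub>R ((x - y) + (norm y - norm x) *\<^sub>R radial y)"
  proof -
    have "radial x - radial y = (1 / norm x) *\<^sub>R (x - y) + (1 / norm x - 1 / norm y) *\<^sub>R y"
      by (simp add: radial_def divide_inverse algebra_simps)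
    also have "1 / norm x - 1 / norm y = (1 / norm x) * ((norm y - norm x) * inverse (norm y))"
      using \<open>x \<noteq> 0\<close> \<open>y \<noteq> 0\<close> by (simp add: field_simps)
    finally show ?thesis by (simp add: radial_def scaleR_add_right)
  qed
  then have "norm (radial x - radial y) = (1 / norm x) * norm ((x - y) + (norm y - norm x) *\<^sub>R radial y)"
    by simp
  also have "\<dots> \<le> 1 * (norm (x - y) + norm ((norm y - norm x) *\<^sub>R radial y))"
    using x by (intro mult_mono norm_triangle_ineq) (auto simp: divide_le_eq_1)
  also have "norm ((norm y - norm x) *\<^sub>R radial y) = \<bar>norm y - norm x\<bar>"
    using \<open>y \<noteq> 0\<close> by (simp add: radial_def abs_mult)
  also have "\<dots> \<le> norm (x - y)"
    by (metis norm_minus_commute norm_triangle_ineq3)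
  finally show "dist (radial x) (radial y) \<le> 2 * dist x y" by (simp add: dist_norm)
qed simp

text \<open>The derivative is the orthogonal projection along q, scaled by 1 / norm q \<le>
  1.\<close>

lemma radial_has_derivative:
  fixes q :: "'a::real_inner"
  assumes q: "1 \<le> norm q"
  obtains N where "(radial has_derivative N) (at q)" "\<And>x. norm (N x) \<le> norm x"
proof -
  have q0: "q \<noteq> 0" using q by auto
  define N where "N h = inverse (norm q) *\<^sub>R h + (- (inverse (norm q) * (h \<bullet> sgn q) * inverse (norm q))) *\<^sub>R q" for h
  have "((\<lambda>q. inverse (norm q) *\<^sub>R q) has_derivative N) (at q)"
    unfolding N_def
    by (rule has_derivative_scaleR[OF Deriv.has_derivative_inverse[OF _ has_derivative_norm[OF q0]] has_derivative_ident])
       (simp add: q0)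
  then have "(radial has_derivative N) (at q)" by (simp add: radial_def[abs_def])
  moreover have "norm (N h) \<le> norm h" for h
  proof -
    define d where "d = h \<bullet> sgn q"
    have s: "sgn q \<bullet> sgn q = 1" using q0 by (simp add: sgn_div_norm power2_norm_eq_inner[symmetric] power2_eq_square)
    have "N h = inverse (norm q) *\<^sub>R (h - d *\<^sub>R sgn q)"
      using q0 by (simp add: N_def d_def sgn_div_norm scaleR_diff_right)
    then have "norm (N h) = inverse (norm q) * norm (h - d *\<^sub>R sgn q)"
      by simp
    also have "\<dots> \<le> 1 * norm (h - d *\<^sub>R sgn q)"
      using q by (intro mult_right_mono) (auto simp: inverse_le_1_iff)
    also have "\<dots> \<le> norm h"
    proof -
      have "h \<bullet> sgn q = d" "sgn q \<bullet> h = d" by (simp_all add: d_def inner_commute)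
      then have "(norm (h - d *\<^sub>R sgn q))\<^sup>2 = (norm h)\<^sup>2 - d\<^sup>2"
        unfolding power2_norm_eq_inner
        by (simp only: inner_diff_left inner_diff_right inner_scaleR_left inner_scaleR_right s) (simp add: power2_eq_square)
      then have "(norm (h - d *\<^sub>R sgn q))\<^sup>2 \<le> (norm h)\<^sup>2"
        using zero_le_power2[of d] by linarith
      then show ?thesis unfolding mult_1_left by (rule power2_le_imp_le) simp
    qed
    finally show ?thesis .
  qed
  ultimately show ?thesis using that by blast
qed

lemma norm_eq_1_if_image_sphere:
  "f ` cball 0 1 \<subseteq> sphere 0 1 \<Longrightarrow> norm u \<le> 1 \<Longrightarrow> norm (f u) = 1"
  by (auto simp: image_subset_iff)

lemma sphere_tangent:
  fixes f :: "complex \<Rightarrow> 'a::real_inner"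
  assumes D: "(f has_derivative D) (at u)" and u: "u \<in> ball 0 1" and sph: "f ` cball 0 1 \<subseteq> sphere 0 1"
  shows "f u \<bullet> D v = 0"
proof -
  have "((\<lambda>u. f u \<bullet> f u) has_derivative (\<lambda>v. f u \<bullet> D v + D v \<bullet> f u)) (at u)"
    by (rule has_derivative_inner[OF D D])
  moreover have "((\<lambda>u. f u \<bullet> f u) has_derivative (\<lambda>v. 0)) (at u)"
  proof (rule has_derivative_transform_within_open[OF has_derivative_const open_ball u])
    fix x :: complex assume "x \<in> ball 0 1"
    then have "norm (f x) = 1" using norm_eq_1_if_image_sphere[OF sph] by simp
    then show "1 = f x \<bullet> f x" by (simp add: norm_eq_1)
  qed
  ultimately have "(\<lambda>v. f u \<bullet> D v + D v \<bullet> f u) = (\<lambda>v. 0)"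
    by (rule has_derivative_unique)
  then have "f u \<bullet> D v + D v \<bullet> f u = 0" by metis
  then show ?thesis by (simp add: inner_commute)
qed

lemma lipschitz_shear: "\<exists>C. C-lipschitz_on (cball 0 1) (shear \<phi>)"
proof -
  obtain C where C: "0 < C" "\<And>p x. norm p \<le> 1 \<Longrightarrow> norm (shear_deriv \<phi> p x) \<le> C * norm x"
    using shear_deriv_bound by blast
  have "C-lipschitz_on (cball 0 1) (shear \<phi>)"
    by (rule bounded_derivative_imp_lipschitz[OF shear_has_derivative])
       (use C in \<open>auto intro!: onorm_bound\<close>)
  then show ?thesis by blast
qed

lemma sheared_spanning_disk:
  fixes g :: nat and t :: real
  assumes f: "spanning_disk (lawson_polygon g) f"
  defines "\<phi> \<equiv> pi / (real g + 1)"
  defines "h \<equiv> \<lambda>u. radial (f u + t *\<^sub>R shear \<phi> (f u))"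
  shows "spanning_disk (lawson_polygon g) h"
    and "AE u in lebesgue. u \<in> ball 0 1 \<longrightarrow> jac h u \<le>
      sqrt (gram (frechet_derivative f (at u) 1 + t *\<^sub>R shear_deriv \<phi> (f u) (frechet_derivative f (at u) 1))
                 (frechet_derivative f (at u) \<i> + t *\<^sub>R shear_deriv \<phi> (f u) (frechet_derivative f (at u) \<i>)))"
proof -
  let ?D = "\<lambda>u. frechet_derivative f (at u)"
  let ?B = "\<lambda>u x. x + t *\<^sub>R shear_deriv \<phi> (f u) x"
  let ?q = "\<lambda>u. f u + t *\<^sub>R shear \<phi> (f u)"
  have lf: "lipschitz_disk f" and sph: "f ` cball 0 1 \<subseteq> sphere 0 1"
    and bij: "bij_betw f (sphere 0 1) (lawson_polygon g)"
    using f by (auto simp: spanning_disk_iff)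
  have q: "1 \<le> norm (?q u)" if "u \<in> cball 0 1" for u
  proof -
    have "norm (f u) = 1" using norm_eq_1_if_image_sphere[OF sph] that by simp
    then show ?thesis using norm_add_shear_ge[of "f u" t \<phi>] by simp
  qed
  have main: "AE u in lebesgue. u \<in> ball 0 1 \<longrightarrow> h differentiable (at u) \<and>
      jac h u \<le> sqrt (gram (?B u (?D u 1)) (?B u (?D u \<i>)))"
    using lipschitz_diskD(2)[OF lf]
  proof eventually_elim
    case (elim u)
    show ?case
    proof
      assume u: "u \<in> ball 0 1"
      then have D: "(f has_derivative ?D u) (at u)" using elim by blast
      obtain N where N: "(radial has_derivative N) (at (?q u))" "\<And>x. norm (N x) \<le> norm x"
        using radial_has_derivative[OF q[of u]] u by auto
      have "(?q has_derivative (\<lambda>x. ?B u (?D u x))) (at u)"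
        by (intro has_derivative_add D has_derivative_scaleR_right has_derivative_compose[OF D shear_has_derivative])
      then have h: "(h has_derivative (\<lambda>x. N (?B u (?D u x)))) (at u)"
        unfolding h_def using N(1) by (rule has_derivative_compose)
      have "gram (N (?B u (?D u 1))) (N (?B u (?D u \<i>))) \<le> gram (?B u (?D u 1)) (?B u (?D u \<i>))"
        by (rule gram_contraction_le[OF has_derivative_linear[OF N(1)] N(2)])
      then show "h differentiable (at u) \<and> jac h u \<le> sqrt (gram (?B u (?D u 1)) (?B u (?D u \<i>)))"
        using h by (auto simp: jac_has_derivative[OF h] differentiable_def)
    qed
  qed
  obtain L where L: "L-lipschitz_on (cball 0 1) f"
    using lf by (auto simp: lipschitz_disk_def)
  obtain C where "C-lipschitz_on (cball 0 1) (shear \<phi>)"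
    using lipschitz_shear by blast
  then have "C-lipschitz_on (f ` cball 0 1) (shear \<phi>)"
    using sph by (elim lipschitz_on_subset) auto
  then have "\<exists>M. M-lipschitz_on (cball 0 1) ?q"
    using lipschitz_on_add[OF L lipschitz_on_cmult[OF lipschitz_on_compose2[OF L]]] by blast
  then obtain M where M: "M-lipschitz_on (cball 0 1) ?q" by blast
  have "2-lipschitz_on (?q ` cball 0 1) (radial :: _ \<Rightarrow> complex \<times> complex)"
    by (rule lipschitz_on_subset[OF lipschitz_radial]) (use q in auto)
  then have "(2 * M)-lipschitz_on (cball 0 1) h"
    unfolding h_def by (rule lipschitz_on_compose2[OF M])
  moreover have "AE u in lebesgue. u \<in> ball 0 1 \<longrightarrow> h differentiable (at u)"
    using main by eventually_elim blast
  ultimately have lh: "lipschitz_disk h" by (auto simp: lipschitz_disk_def)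
  have "h u = f u" if "u \<in> sphere 0 1" for u
  proof -
    have "f u \<in> lawson_polygon g" using bij_betwE[OF bij] that by blast
    moreover have "norm (f u) = 1" using norm_eq_1_if_image_sphere[OF sph] that by simp
    ultimately show ?thesis by (simp add: h_def \<phi>_def shear_lawson_polygon radial_def)
  qed
  then have "bij_betw h (sphere 0 1) (lawson_polygon g)"
    using bij by (subst bij_betw_cong[of _ _ f]) auto
  moreover have "h ` cball 0 1 \<subseteq> sphere 0 1"
  proof
    fix p assume "p \<in> h ` cball 0 1"
    then obtain u where u: "u \<in> cball 0 1" "p = h u" by blast
    then have "?q u \<noteq> 0" using q[OF u(1)] by auto
    then show "p \<in> sphere 0 1" by (simp add: u(2) h_def radial_def)
  qed
  ultimately show "spanning_disk (lawson_polygon g) h"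
    using lh by (simp add: spanning_disk_iff)
  show "AE u in lebesgue. u \<in> ball 0 1 \<longrightarrow> jac h u \<le> sqrt (gram (?B u (?D u 1)) (?B u (?D u \<i>)))"
    using main by eventually_elim blast
qed

section \<open>First variation of a minimizer with vertical tangent planes\<close>

lemma Im_divide_eq_0_if_orthogonal:
  fixes n v w :: complex
  assumes "n \<bullet> v = 0" "n \<bullet> w = 0" "n \<noteq> 0"
  shows "Im (v / w) = 0"
proof -
  \<comment> \<open>Two vectors orthogonal to the same nonzero vector of the plane have zero
    determinant. For w = 0 the quotient is 0 by convention.\<close>
  have "Re n * (Im v * Re w - Re v * Im w) = 0" "Im n * (Im v * Re w - Re v * Im w) = 0"
    using assms(1,2) unfolding inner_complex_def by algebra+
  then have "Im v * Re w - Re v * Im w = 0" using assms(3) by (auto simp: complex_eq_iff)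
  then show ?thesis by (simp add: Im_divide)
qed

lemma bump_nonneg:
  assumes "w \<in> sector \<phi>" "\<phi> \<le> pi"
  shows "0 \<le> bump \<phi> w"
proof -
  obtain r \<theta> where r: "0 \<le> r" "0 \<le> \<theta>" "\<theta> \<le> \<phi>" "w = r *\<^sub>R cis \<theta>"
    using assms(1) by (auto simp: sector_def)
  have "bump \<phi> w = (r * sin \<theta>) * (r * sin (\<phi> - \<theta>))"
    by (simp add: bump_def r(4) sin_diff algebra_simps)
  moreover have "0 \<le> sin \<theta>" "0 \<le> sin (\<phi> - \<theta>)"
    using r assms(2) by (auto intro!: sin_ge_zero)
  ultimately show ?thesis using r(1) by simp
qed

text \<open>Comparison with the sheared disk bounds the integral of \<open>k\<close> times the area
  element by t times a constant for every t > 0. So this integral is 0 and its nonnegative integrand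
  vanishes almost everywhere. On the set where \<open>k\<close> is 0, tangency to hyperplanes makes
  the vertical tangent planes degenerate.\<close>

lemma vertical_minimizer_jac_eq_0:
  fixes g :: nat and f :: "complex \<Rightarrow> complex \<times> complex"
  assumes f: "spanning_disk (lawson_polygon g) f"
    and min: "\<And>h. spanning_disk (lawson_polygon g) h \<Longrightarrow> disk_area f \<le> disk_area h"
    and quad: "\<And>u. 0 \<le> Re (fst (f u))" "\<And>u. 0 \<le> Im (fst (f u))"
    and sec: "\<And>u. snd (f u) \<in> sector (pi / (real g + 1))"
    and vert: "AE u in lebesgue. u \<in> ball 0 1 \<longrightarrow> jac f u = 0 \<or> snd (f u) \<noteq> 0 \<and>
        gram (horizontal (snd (f u)) (frechet_derivative f (at u) 1))
             (horizontal (snd (f u)) (frechet_derivative f (at u) \<i>)) = 0"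
  shows "AE u in lebesgue. u \<in> ball 0 1 \<longrightarrow> jac f u = 0"
proof -
  define \<phi> where "\<phi> = pi / (real g + 1)"
  define k where "k u = bump \<phi> (snd (f u)) * ((1 + \<i>) \<bullet> fst (f u)) / 4" for u
  let ?D = "\<lambda>u. frechet_derivative f (at u)"
  have lf: "lipschitz_disk f" and sph: "f ` cball 0 1 \<subseteq> sphere 0 1"
    using f by (auto simp: spanning_disk_iff)
  have m: "0 \<le> bump \<phi> (snd (f u))" for u
    using bump_nonneg[OF sec] by (simp add: \<phi>_def field_simps)
  have z: "0 \<le> (1 + \<i>) \<bullet> fst (f u)" for u
    using quad[of u] by (simp add: inner_complex_def)
  have k0: "0 \<le> k u" for u using m z by (simp add: k_def)
  obtain C where C: "0 < C" "\<And>p x. norm p \<le> 1 \<Longrightarrow> norm (shear_deriv \<phi> p x) \<le> C * norm x"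
    using shear_deriv_bound by blast
  have jac_le: "AE u in lebesgue. u \<in> ball 0 1 \<longrightarrow>
      jac (\<lambda>u. radial (f u + t *\<^sub>R shear \<phi> (f u))) u \<le> (1 - t * k u + t\<^sup>2 * C\<^sup>2) * jac f u"
    if t: "0 \<le> t" for t
    using sheared_spanning_disk(2)[OF f, of t] lipschitz_diskD(2)[OF lf] vert
  proof eventually_elim
    case (elim u)
    show ?case
    proof
      assume u: "u \<in> ball 0 1"
      have D: "(f has_derivative ?D u) (at u)" using elim u by blast
      have nf: "norm (f u) = 1" using norm_eq_1_if_image_sphere[OF sph] u by simp
      let ?B = "\<lambda>x. x + t *\<^sub>R shear_deriv \<phi> (f u) x"
      have le: "jac (\<lambda>u. radial (f u + t *\<^sub>R shear \<phi> (f u))) u \<le> sqrt (gram (?B (?D u 1)) (?B (?D u \<i>)))"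
        using elim u unfolding \<phi>_def by blast
      also have "\<dots> \<le> (1 - t * k u + t\<^sup>2 * C\<^sup>2) * jac f u"
      proof (cases "jac f u = 0")
        case True
        then have "gram (?D u 1) (?D u \<i>) = 0" by (simp add: jac_def)
        then have "gram (?B (?D u 1)) (?B (?D u \<i>)) = 0"
          by (rule gram_linear_eq_0[OF linear_id_add_shear_deriv])
        then show ?thesis using True by simp
      next
        case False
        then have v: "snd (f u) \<noteq> 0" "gram (horizontal (snd (f u)) (?D u 1)) (horizontal (snd (f u)) (?D u \<i>)) = 0"
          using elim u by blast+
        have tan: "f u \<bullet> ?D u x = 0" for x by (rule sphere_tangent[OF D u sph])
        show ?thesis
          using gram_shear_le[of "fst (f u)" "snd (f u)" \<phi> "?D u 1" "?D u \<i>" C t] nf v quad m tan C t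
          by (simp add: k_def jac_def)
      qed
      finally show "jac (\<lambda>u. radial (f u + t *\<^sub>R shear \<phi> (f u))) u \<le> (1 - t * k u + t\<^sup>2 * C\<^sup>2) * jac f u" .
    qed
  qed
  have int: "set_integrable lebesgue (ball 0 1) (jac f)" by (rule jac_integrable[OF lf])
  have cont: "continuous_on (cball 0 1) k"
    unfolding k_def bump_def by (intro continuous_intros lipschitz_diskD(1)[OF lf]) simp
  obtain K where K: "\<And>u. u \<in> cball 0 1 \<Longrightarrow> \<bar>k u\<bar> \<le> K"
  proof -
    have "bounded (k ` cball 0 1)"
      by (intro compact_imp_bounded compact_continuous_image cont) auto
    then show ?thesis using that unfolding bounded_iff by force
  qed
  have intk: "set_integrable lebesgue (ball 0 1) (\<lambda>u. k u * jac f u)"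
  proof -
    have "(\<lambda>u. indicator (ball 0 1) u *\<^sub>R k u) \<in> borel_measurable borel"
      by (intro borel_measurable_continuous_on_indicator continuous_on_subset[OF cont]) auto
    then have mk: "(\<lambda>u. indicator (ball 0 1) u *\<^sub>R k u) \<in> borel_measurable lebesgue"
      by (intro measurable_completion) simp
    have "(\<lambda>u. (indicator (ball 0 1) u *\<^sub>R k u) * (indicator (ball 0 1) u *\<^sub>R jac f u)) \<in> borel_measurable lebesgue"
      using mk int unfolding set_integrable_def by (intro borel_measurable_times) auto
    also have "(\<lambda>u. (indicator (ball 0 1) u *\<^sub>R k u) * (indicator (ball 0 1) u *\<^sub>R jac f u))
        = (\<lambda>u. indicator (ball 0 1) u *\<^sub>R (k u * jac f u))"
      by (auto simp: indicator_def)
    finally have meas: "(\<lambda>u. indicator (ball 0 1) u *\<^sub>R (k u * jac f u)) \<in> borel_measurable lebesgue" .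
    show ?thesis unfolding set_integrable_def
    proof (rule Bochner_Integration.integrable_bound[OF _ meas])
      show "integrable lebesgue (\<lambda>u. K * (indicator (ball 0 1) u *\<^sub>R jac f u))"
        using int unfolding set_integrable_def by (intro integrable_mult_right) auto
      show "AE u in lebesgue. norm (indicator (ball 0 1) u *\<^sub>R (k u * jac f u))
          \<le> norm (K * (indicator (ball 0 1) u *\<^sub>R jac f u))"
      proof (rule AE_I2)
        fix u :: complex
        show "norm (indicator (ball 0 1) u *\<^sub>R (k u * jac f u)) \<le> norm (K * (indicator (ball 0 1) u *\<^sub>R jac f u))"
          using order_trans[OF K abs_ge_self, of u] by (auto simp: indicator_def abs_mult intro!: mult_right_mono)
      qed
    qed
  qed
  let ?I = "LINT u:ball 0 1|lebesgue. k u * jac f u"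
  have ineq: "?I \<le> t * (C\<^sup>2 * disk_area f)" if t: "0 < t" for t
  proof -
    let ?h = "\<lambda>u. radial (f u + t *\<^sub>R shear \<phi> (f u))"
    have h: "spanning_disk (lawson_polygon g) ?h"
      using sheared_spanning_disk(1)[OF f, of t] by (simp add: \<phi>_def)
    then have lh: "lipschitz_disk ?h" by (simp add: spanning_disk_iff)
    have "disk_area f \<le> disk_area ?h" by (rule min[OF h])
    also have "\<dots> \<le> (LINT u:ball 0 1|lebesgue. (1 + t\<^sup>2 * C\<^sup>2) * jac f u - t * (k u * jac f u))"
      unfolding disk_area_jac
    proof (rule set_integral_mono_AE[OF jac_integrable[OF lh]])
      show "set_integrable lebesgue (ball 0 1) (\<lambda>u. (1 + t\<^sup>2 * C\<^sup>2) * jac f u - t * (k u * jac f u))"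
        by (intro set_integral_diff set_integrable_mult_right int intk)
      show "AE u\<in>ball 0 1 in lebesgue. jac ?h u \<le> (1 + t\<^sup>2 * C\<^sup>2) * jac f u - t * (k u * jac f u)"
        using jac_le[OF less_imp_le[OF t]] by eventually_elim (simp add: algebra_simps)
    qed
    also have "\<dots> = (1 + t\<^sup>2 * C\<^sup>2) * disk_area f - t * ?I"
      unfolding disk_area_jac
      by (subst set_integral_diff) (auto intro!: int intk set_integrable_mult_right)
    finally have "t * ?I \<le> t * (t * (C\<^sup>2 * disk_area f))"
      by (simp add: algebra_simps power2_eq_square)
    then show ?thesis using t by simp
  qed
  have "?I \<le> 0"
  proof (rule tendsto_lowerbound)
    show "((\<lambda>t. t * (C\<^sup>2 * disk_area f)) \<longlongrightarrow> 0) (at_right 0)"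
      by (auto intro!: tendsto_eq_intros)
    show "\<forall>\<^sub>F t in at_right 0. ?I \<le> t * (C\<^sup>2 * disk_area f)"
      using ineq by (auto simp: eventually_at_right_less intro: eventually_mono[OF eventually_at_right_less])
  qed simp
  moreover have nn: "AE u in lebesgue. 0 \<le> indicator (ball 0 1) u *\<^sub>R (k u * jac f u)"
    using k0 jac_nonneg[of f] by (simp add: indicator_def)
  ultimately have "?I = 0"
    unfolding set_lebesgue_integral_def using integral_nonneg_AE[OF nn] by linarith
  then have "AE u in lebesgue. indicator (ball 0 1) u *\<^sub>R (k u * jac f u) = 0"
    using integral_nonneg_eq_0_iff_AE[OF _ nn] intk
    unfolding set_lebesgue_integral_def set_integrable_def by blast
  \<comment> \<open>These hyperplanes cover the zeros of \<open>k\<close>: two of them cut out z =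
    0, the other two contain the boundary rays of the sector.\<close>
  moreover note AE_derivative_zero_on_hyperplane[OF lf, of "(1, 0)"]
    AE_derivative_zero_on_hyperplane[OF lf, of "(\<i>, 0)"]
    AE_derivative_zero_on_hyperplane[OF lf, of "(0, \<i>)"]
    AE_derivative_zero_on_hyperplane[OF lf, of "(0, - \<i> * cis \<phi>)"]
    lipschitz_diskD(2)[OF lf] vert
  ultimately show ?thesis
  proof eventually_elim
    case (elim u)
    show ?case
    proof (intro impI)
      assume u: "u \<in> ball 0 1"
      let ?w = "snd (f u)"
      have D: "(f has_derivative ?D u) (at u)" using elim u by blast
      have tan: "f u \<bullet> ?D u x = 0" for x by (rule sphere_tangent[OF D u sph])
      show "jac f u = 0"
      proof (rule ccontr)
        assume j: "jac f u \<noteq> 0"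
        then have w: "?w \<noteq> 0" and v: "gram (horizontal ?w (?D u 1)) (horizontal ?w (?D u \<i>)) = 0"
          using elim u by blast+
        have k: "k u = 0" using elim(1) u j by simp
        \<comment> \<open>The horizontal parts are already parallel; without angular parts the whole
          Gram determinant vanishes.\<close>
        have flat: False if "\<And>x. Im (snd (?D u x) / ?w) = 0"
        proof -
          have "angular ?w (?D u x) = 0" for x using that by (simp add: angular_def)
          then have "gram (?D u 1) (?D u \<i>) = 0"
            unfolding gram_polar[OF w] by (simp add: gram_orthogonal_split v)
          then show False using j by (simp add: jac_def)
        qed
        consider "(1 + \<i>) \<bullet> fst (f u) = 0" | "Im ?w = 0" | "Im (cis \<phi> * cnj ?w) = 0"
          using k by (auto simp: k_def bump_def)
        then show False
        proof cases
          case 1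
          then have "Re (fst (f u)) = 0" "Im (fst (f u)) = 0"
            using quad[of u] by (simp_all add: inner_complex_def)
          then have f0: "fst (f u) = 0" and D0: "fst (?D u x) = 0" for x
            using elim u by (auto simp: inner_prod_def inner_complex_def complex_eq_iff)
          \<comment> \<open>At z = 0 tangency to the sphere removes the radial part of the
            w-component, so only the rotation direction is left.\<close>
          have "Re (snd (?D u x) / ?w) = 0" for x
            using tan[of x] f0 by (simp add: inner_prod_def inner_complex_def Re_divide algebra_simps)
          then have "horizontal ?w (?D u x) = 0" for x using D0 by (simp add: horizontal_def zero_prod_def)
          then have "gram (?D u 1) (?D u \<i>) = 0"
            unfolding gram_polar[OF w] by (simp add: gram_def power2_eq_square)
          then show False using j by (simp add: jac_def)
        next
          case 2
          then have "\<i> \<bullet> ?w = 0" "\<i> \<bullet> snd (?D u x) = 0" for x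
            using elim u by (auto simp: inner_prod_def)
          then show False by (intro flat Im_divide_eq_0_if_orthogonal[of \<i>]) auto
        next
          case 3
          let ?n = "- \<i> * cis \<phi>"
          have n: "?n \<bullet> ?w = 0" using 3 by (simp add: inner_complex_def algebra_simps)
          then have "?n \<bullet> snd (?D u x) = 0" for x
            using elim u by (auto simp: inner_prod_def)
          then show False using n by (intro flat Im_divide_eq_0_if_orthogonal[of ?n]) auto
        qed
      qed
    qed
  qed
qed

section \<open>Nondegeneracy\<close>

lemma lipschitz_disk_linear_compose:
  fixes A :: "'a::euclidean_space \<Rightarrow> 'b::euclidean_space"
  assumes A: "linear A" and f: "lipschitz_disk f"
  shows "lipschitz_disk (A \<circ> f)"
    and "AE u in lebesgue. u \<in> ball 0 1 \<longrightarrow> jac (A \<circ> f) u =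
      sqrt (gram (A (frechet_derivative f (at u) 1)) (A (frechet_derivative f (at u) \<i>)))"
proof -
  obtain B where "B-lipschitz_on UNIV A"
    using bounded_linear.lipschitz_boundE[OF linear_conv_bounded_linear[THEN iffD1, OF A]] by metis
  moreover obtain L where L: "L-lipschitz_on (cball 0 1) f"
    using f by (auto simp: lipschitz_disk_def)
  ultimately have Lip: "(B * L)-lipschitz_on (cball 0 1) (A \<circ> f)"
    by (intro lipschitz_on_compose) (auto elim: lipschitz_on_subset)
  have der: "(A \<circ> f has_derivative (\<lambda>v. A (frechet_derivative f (at u) v))) (at u)"
    if "(f has_derivative frechet_derivative f (at u)) (at u)" for u
    unfolding o_def by (rule has_derivative_compose[OF that linear_imp_has_derivative[OF A]])
  have "AE u in lebesgue. u \<in> ball 0 1 \<longrightarrow> A \<circ> f differentiable (at u)"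
    using lipschitz_diskD(2)[OF f] by eventually_elim (use der in \<open>auto simp: differentiable_def\<close>)
  then show "lipschitz_disk (A \<circ> f)" using Lip by (auto simp: lipschitz_disk_def)
  show "AE u in lebesgue. u \<in> ball 0 1 \<longrightarrow> jac (A \<circ> f) u =
      sqrt (gram (A (frechet_derivative f (at u) 1)) (A (frechet_derivative f (at u) \<i>)))"
    using lipschitz_diskD(2)[OF f] by eventually_elim (use jac_has_derivative[OF der] in blast)
qed

lemma disk_area_isometry:
  assumes A: "linear A" "\<And>x. norm (A x) = norm x" and f: "lipschitz_disk f"
  shows "disk_area (A \<circ> f) = disk_area f"
proof (rule disk_area_cong[OF lipschitz_disk_linear_compose(1)[OF A(1) f] f])
  show "AE u in lebesgue. u \<in> ball 0 1 \<longrightarrow> jac (A \<circ> f) u = jac f u"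
    using lipschitz_disk_linear_compose(2)[OF A(1) f]
    by eventually_elim (simp add: gram_isometry[OF A] jac_def)
qed

text \<open>If a point y of the ball were missed, retracting the complement of y onto the circle and
  then undoing G there by its inverse \<open>K\<close> would retract the disk onto its
  boundary.\<close>

lemma ball_subset_image_if_bij_sphere:
  fixes G :: "complex \<Rightarrow> complex"
  assumes cont: "continuous_on (cball 0 1) G" and bij: "bij_betw G (sphere 0 1) (sphere 0 1)"
  shows "ball 0 1 \<subseteq> G ` cball 0 1"
proof (rule ccontr)
  assume "\<not> ball 0 1 \<subseteq> G ` cball 0 1"
  then obtain y where y: "y \<in> ball 0 1" "y \<notin> G ` cball 0 1" by blast
  obtain r where r: "retraction (- {y}) (sphere 0 1) r"
    using sphere_retract_of_punctured_universe_gen[OF y(1)] by (auto simp: retract_of_def)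
  have "continuous_on (sphere 0 1) G" by (rule continuous_on_subset[OF cont]) auto
  then obtain K where K: "homeomorphism (sphere 0 1) (sphere 0 1) G K"
    using homeomorphism_compact[of "sphere 0 1" G] bij by (auto simp: bij_betw_def)
  have sub: "G ` cball 0 1 \<subseteq> - {y}" using y by blast
  have rs: "r ` (- {y}) \<subseteq> sphere 0 1" and rc: "continuous_on (- {y}) r" and ri: "\<And>x. x \<in> sphere 0 1 \<Longrightarrow> r x = x"
    using r by (auto simp: retraction_def)
  have "retraction (cball 0 1) (sphere 0 1) (K \<circ> (r \<circ> G))"
    unfolding retraction_def
  proof (intro conjI ballI)
    have "(r \<circ> G) ` cball 0 1 \<subseteq> sphere 0 1" using rs sub by (auto simp: image_subset_iff)
    then show "continuous_on (cball 0 1) (K \<circ> (r \<circ> G))"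
      using sub
      by (intro continuous_on_compose cont continuous_on_subset[OF rc] continuous_on_subset[OF homeomorphism_cont2[OF K]]) auto
    show "K \<circ> (r \<circ> G) \<in> cball 0 1 \<rightarrow> sphere 0 1"
    proof
      fix x :: complex assume "x \<in> cball 0 1"
      then have "r (G x) \<in> sphere 0 1" using rs sub by blast
      then show "(K \<circ> (r \<circ> G)) x \<in> sphere 0 1"
        using homeomorphism_image2[OF K] by auto
    qed
    fix x :: complex assume x: "x \<in> sphere 0 1"
    then have "G x \<in> sphere 0 1" using bij_betwE[OF bij] by blast
    then show "(K \<circ> (r \<circ> G)) x = x" using homeomorphism_apply1[OF K x] ri by simp
  qed auto
  then show False
    using no_retraction_cball[of 1 "0::complex"] by (auto simp: retract_of_def)
qed

text \<open>A linear map carries the arc cos t p + sin t q to the arc built from the images of p and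
  q. So it suffices to send the P vertices to 1 and -1 and the Q vertices to \<i> and -\<i>: the
  four edges become the four quarter circles.\<close>

lemma bij_betw_lawson_polygon_circle:
  fixes g :: nat
  assumes "1 \<le> g"
  obtains A :: "complex \<times> complex \<Rightarrow> complex" where "linear A" "bij_betw A (lawson_polygon g) (sphere 0 1)"
proof -
  define \<phi> where "\<phi> = pi / (real g + 1)"
  have "0 < \<phi>" "\<phi> < pi" using assms by (auto simp: \<phi>_def field_simps)
  then have s: "sin \<phi> \<noteq> 0" using sin_gt_zero by force
  \<comment> \<open>The solution of cos \<phi> - k sin \<phi> = -1, which sends the second Q vertex
    to -\<i>.\<close>
  define k where "k = (1 + cos \<phi>) / sin \<phi>"
  have k: "k * sin \<phi> = 1 + cos \<phi>" using s by (simp add: k_def)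
  define A :: "complex \<times> complex \<Rightarrow> complex" where
    "A p = Complex (Re (fst p) - Im (fst p)) (Re (snd p) - k * Im (snd p))" for p
  define B :: "complex \<Rightarrow> complex \<times> complex" where
    "B x = (\<bar>Re x\<bar> *\<^sub>R (if 0 \<le> Re x then 1 else \<i>), \<bar>Im x\<bar> *\<^sub>R (if 0 \<le> Im x then 1 else cis \<phi>))" for x
  have A: "A (x *\<^sub>R a, y *\<^sub>R b) = Complex (if a = 1 then x else - x) (if b = 1 then y else - y)"
    if "a \<in> {1, \<i>}" "b \<in> {1, cis \<phi>}" for x y a b
  proof -
    have "k * (y * sin \<phi>) = y * (1 + cos \<phi>)" using k by (simp add: mult.left_commute)
    then show ?thesis using that s by (auto simp: A_def complex_eq_iff algebra_simps)
  qed
  have "linear A" by (auto simp: linear_iff A_def complex_eq_iff algebra_simps)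
  moreover have "bij_betw A (lawson_polygon g) (sphere 0 1)"
  proof (rule bij_betw_byWitness[where f' = B])
    have G: "\<exists>t a b. t \<in> {0..pi/2} \<and> a \<in> {1, \<i>} \<and> b \<in> {1, cis \<phi>} \<and> p = (cos t *\<^sub>R a, sin t *\<^sub>R b)"
      if "p \<in> lawson_polygon g" for p
      using that unfolding lawson_polygon_iff \<phi>_def by blast
    show "\<forall>p\<in>lawson_polygon g. B (A p) = p"
    proof
      fix p assume "p \<in> lawson_polygon g"
      then obtain t a b where t: "t \<in> {0..pi/2}" "a \<in> {1, \<i>}" "b \<in> {1, cis \<phi>}" "p = (cos t *\<^sub>R a, sin t *\<^sub>R b)"
        using G by blast
      have "0 \<le> cos t" "0 \<le> sin t" using t(1) by (auto intro: cos_ge_zero sin_ge_zero)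
      then show "B (A p) = p"
        using t(2,3) unfolding t(4) A[OF t(2,3)] B_def by (auto simp del: scaleR_conv_of_real)
    qed
    show "\<forall>x\<in>sphere 0 1. A (B x) = x"
      unfolding B_def using s by (auto simp: A complex_eq_iff)
    show "A ` lawson_polygon g \<subseteq> sphere 0 1"
    proof clarify
      fix z w assume "(z, w) \<in> lawson_polygon g"
      then obtain t a b where t: "a \<in> {1, \<i>}" "b \<in> {1, cis \<phi>}" "(z, w) = (cos t *\<^sub>R a, sin t *\<^sub>R b)"
        using G by blast
      show "A (z, w) \<in> sphere 0 1"
        unfolding t(3) A[OF t(1,2)] by (simp add: cmod_def)
    qed
    show "B ` sphere 0 1 \<subseteq> lawson_polygon g"
    proof
      fix p assume "p \<in> B ` sphere 0 1"
      then obtain x where x: "cmod x = 1" "p = B x" by auto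
      have "\<bar>Re x\<bar>\<^sup>2 + \<bar>Im x\<bar>\<^sup>2 = 1" using x(1) by (simp flip: cmod_power2)
      then obtain t where "0 \<le> t" "t \<le> pi / 2" "\<bar>Re x\<bar> = cos t" "\<bar>Im x\<bar> = sin t"
        using sincos_total_pi_half[of "\<bar>Re x\<bar>" "\<bar>Im x\<bar>"] by auto
      then show "p \<in> lawson_polygon g"
        unfolding x(2) B_def lawson_polygon_iff \<phi>_def
        by (intro bexI[of _ t] bexI[of _ "if 0 \<le> Re x then 1 else \<i>"]
            bexI[of _ "if 0 \<le> Im x then 1 else cis (pi / (real g + 1))"]) auto
    qed
  qed
  ultimately show ?thesis using that by blast
qed

lemma spanning_disk_jac_not_AE_0:
  fixes g :: nat
  assumes f: "spanning_disk (lawson_polygon g) f" and "1 \<le> g"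
  shows "\<not> (AE u in lebesgue. u \<in> ball 0 1 \<longrightarrow> jac f u = 0)"
proof
  assume zero: "AE u in lebesgue. u \<in> ball 0 1 \<longrightarrow> jac f u = 0"
  have lf: "lipschitz_disk f" and bij: "bij_betw f (sphere 0 1) (lawson_polygon g)"
    using f by (auto simp: spanning_disk_iff)
  obtain A :: "complex \<times> complex \<Rightarrow> complex" where A: "linear A" "bij_betw A (lawson_polygon g) (sphere 0 1)"
    using bij_betw_lawson_polygon_circle[OF \<open>1 \<le> g\<close>] by blast
  have lG: "lipschitz_disk (A \<circ> f)" by (rule lipschitz_disk_linear_compose[OF A(1) lf])
  have "AE u in lebesgue. u \<in> ball 0 1 \<longrightarrow> jac (A \<circ> f) u = 0"
    using lipschitz_disk_linear_compose(2)[OF A(1) lf] zero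
    by eventually_elim (simp add: jac_def gram_linear_eq_0[OF A(1)])
  then have "negligible ((A \<circ> f) ` cball 0 1)" by (rule negligible_lipschitz_disk_image[OF lG])
  moreover have "ball 0 1 \<subseteq> (A \<circ> f) ` cball 0 1"
    by (rule ball_subset_image_if_bij_sphere[OF lipschitz_diskD(1)[OF lG] bij_betw_trans[OF bij A(2)]])
  ultimately have "negligible (ball (0::complex) 1)" by (rule negligible_subset)
  then show False by (simp add: negligible_convex_interior interior_open)
qed

section \<open>The pieces of the surface\<close>

text \<open>Explicit model of the reflection group. The half-turn for (a, 0) and (0, b) is (z, w)
  \<mapsto> (a^2 cnj z, b^2 cnj w), so products multiply z by a sign s and w by a (g + 1)-th root of
  unity \<zeta>, with conjugation if c holds.\<close>

definition symmetry :: "complex \<times> complex \<times> bool \<Rightarrow> complex \<times> complex \<Rightarrow> complex \<times> complex" where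
  "symmetry = (\<lambda>(s, \<zeta>, c) p. if c then (s * cnj (fst p), \<zeta> * cnj (snd p)) else (s * fst p, \<zeta> * snd p))"

definition symmetry_params :: "nat \<Rightarrow> (complex \<times> complex \<times> bool) set" where
  "symmetry_params g = {1, -1} \<times> {\<zeta>. \<zeta> ^ (g + 1) = 1} \<times> UNIV"

lemma card_symmetry_params: "card (symmetry_params g) = 4 * (g + 1)"
  using card_roots_unity_eq[of "g + 1"] by (simp add: symmetry_params_def card_cartesian_product)

lemma half_turn_apply:
  assumes "cmod a = 1" "cmod b = 1"
  shows "half_turn (a, 0) (0, b) p = (a\<^sup>2 * cnj (fst p), b\<^sup>2 * cnj (snd p))"
proof -
  \<comment> \<open>In one complex plane, reflection across the real line through a unit c is x
    \<mapsto> c^2 cnj x.\<close>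
  have *: "(2 * (x \<bullet> c)) *\<^sub>R c - x = c\<^sup>2 * cnj x" if "cmod c = 1" for c x
  proof -
    have "(Re c)\<^sup>2 + (Im c)\<^sup>2 = 1" using that by (simp flip: cmod_power2)
    then have "Re x * (Re c)\<^sup>2 + Re x * (Im c)\<^sup>2 = Re x" "Im x * (Re c)\<^sup>2 + Im x * (Im c)\<^sup>2 = Im x"
      by (simp_all flip: distrib_left)
    then show ?thesis
      by (simp add: complex_eq_iff inner_complex_def power2_eq_square algebra_simps)
  qed
  show ?thesis
    using *[OF assms(1), of "fst p"] *[OF assms(2), of "snd p"]
    by (cases p) (simp add: half_turn_def)
qed

lemma Q_vertices_eq: "q \<in> Q_vertices g \<longleftrightarrow> (\<exists>b. q = (0, b) \<and> b \<in> {1, cis (pi / (real g + 1))})"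
  by (auto simp: Q_vertices_def)

lemma P_vertices_eq: "p \<in> P_vertices \<longleftrightarrow> (\<exists>a. p = (a, 0) \<and> a \<in> {1, \<i>})"
  by (auto simp: P_vertices_def)

lemma root_unity_square: "b \<in> {1, cis (pi / (real g + 1))} \<Longrightarrow> (b\<^sup>2) ^ (g + 1) = 1"
proof -
  assume "b \<in> {1, cis (pi / (real g + 1))}"
  moreover have "(cis (pi / (real g + 1)))\<^sup>2 ^ (g + 1) = cis (2 * pi)"
  proof -
    have "real (g + 1) * (real 2 * (pi / (real g + 1))) = 2 * pi" by (simp add: field_simps)
    then show ?thesis by (simp only: Complex.DeMoivre)
  qed
  ultimately show ?thesis by auto
qed

lemma lawson_pieces_subset: "lawson_pieces g f \<subseteq> (\<lambda>i. symmetry i \<circ> f) ` symmetry_params g"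
proof
  fix h assume "h \<in> lawson_pieces g f"
  then show "h \<in> (\<lambda>i. symmetry i \<circ> f) ` symmetry_params g"
  proof induction
    case disk
    show ?case
      by (rule image_eqI[of _ _ "(1, 1, False)"]) (auto simp: symmetry_def symmetry_params_def fun_eq_iff)
  next
    case (reflect h p q)
    obtain s \<zeta> c where h: "h = symmetry (s, \<zeta>, c) \<circ> f" "s \<in> {1, -1}" "\<zeta> ^ (g + 1) = 1"
      using reflect.IH unfolding symmetry_params_def by blast
    obtain a b where pq: "p = (a, 0)" "q = (0, b)" "a \<in> {1, \<i>}" "b \<in> {1, cis (pi / (real g + 1))}"
      using reflect by (auto simp: P_vertices_eq Q_vertices_eq)
    have n: "cmod a = 1" "cmod b = 1" using pq by auto
    have "half_turn p q \<circ> h = symmetry (a\<^sup>2 * s, b\<^sup>2 * cnj \<zeta>, \<not> c) \<circ> f"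
      using h(2) by (auto simp: h(1) pq(1,2) half_turn_apply[OF n] symmetry_def fun_eq_iff)
    moreover have "(b\<^sup>2 * cnj \<zeta>) ^ (g + 1) = 1"
      using root_unity_square[OF pq(4)] h(3) by (metis complex_cnj_one complex_cnj_power mult.right_neutral power_mult_distrib)
    then have "(a\<^sup>2 * s, b\<^sup>2 * cnj \<zeta>, \<not> c) \<in> symmetry_params g"
      using pq(3) h(2) by (auto simp: symmetry_params_def)
    ultimately show ?case by blast
  qed
qed

text \<open>Two half-turns with a common Q vertex compose to z \<mapsto> -z, two with a common P
  vertex to a rotation of w by 2 pi / (g + 1) up to orientation. Together with one conjugation these
  give every element.\<close>

lemma symmetry_comp_in_lawson_pieces:
  assumes "i \<in> symmetry_params g"
  shows "symmetry i \<circ> f \<in> lawson_pieces g f"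
proof -
  define \<alpha> where "\<alpha> = pi / (real g + 1)"
  have P: "(1, 0) \<in> P_vertices" "(\<i>, 0) \<in> P_vertices" and Q: "(0, 1) \<in> Q_vertices g" "(0, cis \<alpha>) \<in> Q_vertices g"
    by (auto simp: P_vertices_def Q_vertices_def \<alpha>_def)
  note refl = lawson_pieces.reflect
  have neg: "(\<lambda>p. (- fst p, snd p)) \<circ> h \<in> lawson_pieces g f" if "h \<in> lawson_pieces g f" for h
    using refl[OF refl[OF that P(1) Q(1)] P(2) Q(1)]
    by (simp add: half_turn_apply o_def)
  have rot: "(\<lambda>p. (fst p, (cis \<alpha>)\<^sup>2 * snd p)) \<circ> h \<in> lawson_pieces g f" if "h \<in> lawson_pieces g f" for h
    using refl[OF refl[OF that P(1) Q(1)] P(1) Q(2)]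
    by (simp add: half_turn_apply o_def)
  have conj: "(\<lambda>p. (cnj (fst p), cnj (snd p))) \<circ> f \<in> lawson_pieces g f"
    using refl[OF lawson_pieces.disk P(1) Q(1)] by (simp add: half_turn_apply o_def)
  have rots: "(\<lambda>p. (fst p, ((cis \<alpha>)\<^sup>2) ^ k * snd p)) \<circ> h \<in> lawson_pieces g f" if "h \<in> lawson_pieces g f" for h k
  proof (induction k)
    case 0
    then show ?case using that by (simp add: o_def)
  next
    case (Suc k)
    then show ?case using rot[OF Suc] by (simp add: o_def mult.assoc)
  qed
  obtain s \<zeta> c where i: "i = (s, \<zeta>, c)" "s \<in> {1, -1}" "\<zeta> ^ (g + 1) = 1"
    using assms by (auto simp: symmetry_params_def)
  obtain k where "\<zeta> = cis (2 * pi * real k / real (g + 1))"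
    using bij_betw_imp_surj_on[OF Complex.bij_betw_roots_unity[of "g + 1"]] i(3) by auto
  then have \<zeta>: "\<zeta> = ((cis \<alpha>)\<^sup>2) ^ k"
    by (simp add: Complex.DeMoivre \<alpha>_def algebra_simps)
  define h where "h = (if c then (\<lambda>p. (cnj (fst p), cnj (snd p))) \<circ> f else f)"
  have "h \<in> lawson_pieces g f" using conj lawson_pieces.disk by (simp add: h_def)
  note r = rots[OF this, of k]
  show ?thesis
  proof (cases "s = 1")
    case True
    then have "symmetry i \<circ> f = (\<lambda>p. (fst p, ((cis \<alpha>)\<^sup>2) ^ k * snd p)) \<circ> h"
      by (auto simp: i(1) \<zeta> symmetry_def h_def fun_eq_iff)
    then show ?thesis using r by simp
  next
    case False
    then have "s = -1" using i by simp
    then have "symmetry i \<circ> f = (\<lambda>p. (- fst p, snd p)) \<circ> ((\<lambda>p. (fst p, ((cis \<alpha>)\<^sup>2) ^ k * snd p)) \<circ> h)"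
      by (auto simp: i(1) \<zeta> symmetry_def h_def fun_eq_iff)
    then show ?thesis using neg[OF r] by simp
  qed
qed

lemma lawson_pieces_eq: "lawson_pieces g f = (\<lambda>i. symmetry i \<circ> f) ` symmetry_params g"
  by (rule equalityI[OF lawson_pieces_subset image_subsetI]) (rule symmetry_comp_in_lawson_pieces)

text \<open>The values at (1, 0), (0, 1) and (\<i>, 0) recover s, \<zeta> and c in turn. Injectivity
  matters because the area is a sum over a set, where coinciding pieces would count once.\<close>

lemma inj_on_symmetry_comp:
  assumes "{(1, 0), (\<i>, 0), (0, 1)} \<subseteq> range f"
  shows "inj_on (\<lambda>i. symmetry i \<circ> f) (symmetry_params g)"
proof (rule inj_onI)
  fix i j assume i: "i \<in> symmetry_params g" and j: "j \<in> symmetry_params g" and eq: "symmetry i \<circ> f = symmetry j \<circ> f"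
  have *: "symmetry i p = symmetry j p" if "p \<in> {(1, 0), (\<i>, 0), (0, 1)}" for p
  proof -
    have "p \<in> range f" using subsetD[OF assms that] .
    then obtain u where "p = f u" by (rule rangeE)
    then show ?thesis using fun_cong[OF eq, of u] by simp
  qed
  obtain s \<zeta> c s' \<zeta>' c' where ij: "i = (s, \<zeta>, c)" "j = (s', \<zeta>', c')" "s \<in> {1, -1}"
    using i j unfolding symmetry_params_def by (cases i, cases j) blast
  have "s = s'" "\<zeta> = \<zeta>'"
    using *[of "(1, 0)"] *[of "(0, 1)"] by (auto simp: ij(1,2) symmetry_def split: if_splits)
  moreover have "c = c'"
    using *[of "(\<i>, 0)"] ij(3) \<open>s = s'\<close> by (auto simp: ij(1,2) symmetry_def complex_eq_iff split: if_splits)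
  ultimately show "i = j" by (simp add: ij)
qed

lemma symmetry_isometry:
  assumes "i \<in> symmetry_params g"
  shows "linear (symmetry i)" "norm (symmetry i p) = norm p"
proof -
  obtain s \<zeta> c where i: "i = (s, \<zeta>, c)" "s \<in> {1, -1}" "\<zeta> ^ (g + 1) = 1"
    using assms by (auto simp: symmetry_params_def)
  show "linear (symmetry i)"
    by (auto simp: linear_iff i(1) symmetry_def algebra_simps)
  have "cmod \<zeta> = 1" using power_eq_1_iff[OF i(3)] by simp
  moreover have "cmod s = 1" using i(2) by auto
  ultimately show "norm (symmetry i p) = norm p"
    by (cases p) (simp add: i(1) symmetry_def norm_Pair norm_mult)
qed

lemma surface_area_lawson_pieces:
  assumes f: "spanning_disk (lawson_polygon g) f"
  shows "surface_area (lawson_pieces g f) = 4 * (real g + 1) * disk_area f"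
proof -
  have lf: "lipschitz_disk f" and bij: "bij_betw f (sphere 0 1) (lawson_polygon g)"
    using f by (auto simp: spanning_disk_iff)
  have "(1, 0) \<in> lawson_polygon g" "(\<i>, 0) \<in> lawson_polygon g"
    unfolding lawson_polygon_iff by (force intro!: bexI[of _ 0])+
  moreover have "(0, 1) \<in> lawson_polygon g"
    unfolding lawson_polygon_iff by (force intro!: bexI[of _ "pi/2"])
  ultimately have "{(1, 0), (\<i>, 0), (0, 1)} \<subseteq> range f"
    using bij_betw_imp_surj_on[OF bij] by blast
  then have "surface_area (lawson_pieces g f) = (\<Sum>i\<in>symmetry_params g. disk_area (symmetry i \<circ> f))"
    unfolding surface_area_def lawson_pieces_eq by (subst sum.reindex[OF inj_on_symmetry_comp]) auto
  also have "\<dots> = (\<Sum>i\<in>symmetry_params g. disk_area f)"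
    by (intro sum.cong refl disk_area_isometry symmetry_isometry lf)
  also have "\<dots> = 4 * (real g + 1) * disk_area f"
    by (simp add: card_symmetry_params)
  finally show ?thesis .
qed

theorem theorem5:
  fixes g :: nat and S S' :: "(complex \<Rightarrow> complex \<times> complex) set"
  assumes "lawson_surface g S" and "lawson_surface (Suc g) S'"
  shows "surface_area S < surface_area S'"
proof -
  obtain f0 where S: "S = lawson_pieces g f0" and f0: "plateau_disk (lawson_polygon g) f0"
    using assms(1) by (auto simp: lawson_surface_def)
  obtain f1 where S': "S' = lawson_pieces (Suc g) f1" and f1: "plateau_disk (lawson_polygon (Suc g)) f1"
    using assms(2) by (auto simp: lawson_surface_def)
  have f0': "spanning_disk (lawson_polygon g) f0"
    "\<And>h. spanning_disk (lawson_polygon g) h \<Longrightarrow> disk_area f0 \<le> disk_area h"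
    using f0 by (auto simp: plateau_disk_def)
  have f1': "spanning_disk (lawson_polygon (Suc g)) f1"
    "\<And>h. spanning_disk (lawson_polygon (Suc g)) h \<Longrightarrow> disk_area f1 \<le> disk_area h"
    using f1 by (auto simp: plateau_disk_def)
  \<comment> \<open>Taking j = 1 folds down to the sector of the polygon itself. The area is
    unchanged, so \<open>f\<close> is again a minimizer for \<open>Suc g\<close>.\<close>
  obtain f where f: "spanning_disk (lawson_polygon (Suc g)) f" "disk_area f = disk_area f1"
    and quad: "\<And>u. 0 \<le> Re (fst (f u))" "\<And>u. 0 \<le> Im (fst (f u))"
    and sec: "\<And>u. snd (f u) \<in> sector (pi / (real (Suc g) + 1))"
    using folded_spanning_disk[OF f1'(1), of 1] by auto
  have sec2: "\<And>u. snd (f u) \<in> sector (pi / (real g + 2))" using sec by (simp add: add.commute)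
  define c where "c = (real g + 2) / (real g + 1)"
  define h where "h u = (fst (f u), stretch c (snd (f u)))" for u
  have h_eq: "h = (\<lambda>u. (fst (f u), stretch ((real g + 2) / (real g + 1)) (snd (f u))))"
    by (simp add: h_def c_def fun_eq_iff)
  note h = stretched_spanning_disk[OF f(1) sec2, folded h_eq c_def]
  have "disk_area f0 < c * disk_area f1"
  proof (rule ccontr)
    assume "\<not> disk_area f0 < c * disk_area f1"
    \<comment> \<open>\<open>h\<close> spans the polygon of genus g, so its area is at least that of
      \<open>f0\<close>; the stretch bound is then attained.\<close>
    then have "c * disk_area f \<le> disk_area h"
      using f0'(2)[OF h(1)] f(2) by simp
    moreover have "lipschitz_disk h" "lipschitz_disk f"
      using h(1) f(1) by (auto simp: spanning_disk_iff)
    ultimately have "AE u in lebesgue. u \<in> ball 0 1 \<longrightarrow> jac h u = c * jac f u"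
      by (intro disk_area_mono_eqD h(2))
    with h(3) have vert: "AE u in lebesgue. u \<in> ball 0 1 \<longrightarrow> jac f u = 0 \<or> snd (f u) \<noteq> 0 \<and>
        gram (horizontal (snd (f u)) (frechet_derivative f (at u) 1))
             (horizontal (snd (f u)) (frechet_derivative f (at u) \<i>)) = 0"
      by eventually_elim blast
    have "AE u in lebesgue. u \<in> ball 0 1 \<longrightarrow> jac f u = 0"
      by (rule vertical_minimizer_jac_eq_0[OF f(1) _ quad sec vert]) (use f(2) f1'(2) in simp)
    then show False using spanning_disk_jac_not_AE_0[OF f(1)] by simp
  qed
  then have "(real g + 1) * disk_area f0 < (real g + 1) * (c * disk_area f1)"
    by (intro mult_strict_left_mono) auto
  also have "\<dots> = (real g + 2) * disk_area f1" by (simp add: c_def)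
  finally show ?thesis
    unfolding S S' surface_area_lawson_pieces[OF f0'(1)] surface_area_lawson_pieces[OF f1'(1)] by (simp add: algebra_simps)
qed

end
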